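(* Let $a$ satisfy assumption (a) of the context. The single layer potential $S\varphi$ with bounded measurable density $\varphi$ on $\partial\Omega\times[0,T]$, $$(S\varphi)(x,t)=\int_0^t\int_{\partial\Omega}\varepsilon_{n,a}(x-\xi,b(t,\tau))\,\varphi(\xi,\tau)\,a(\tau)\,dS_\xi\,d\tau,$$ is continuous in $\mathbb{R}^n\times(0,T]$. In particular, it is continuous across the boundary $\partial\Omega$.
   Context: Setting: $0<T<\infty$, $n\ge 2$, $\Omega\subset\mathbb{R}^n$ is a bounded domain with boundary $\partial\Omega\in C^{1+\lambda}$, $0<\lambda<1$. The coefficient $a\in L_1[0,T]$ is defined on $[0,T]$. Assumption (a): $a(t)$ is nonnegative and becomes zero only at isolated points. Notation: $a_1(t)=\int_0^t a(z)\,dz$, $b(t,\tau)=\int_\tau^t a(z)\,dz=a_1(t)-a_1(\tau)$, $\varepsilon_n(x,t)=\theta(t)(4\pi t)^{-n/2}e^{-|x|^2/(4t)}$ is the fundamental solution of the standard heat operator ($\theta$ is the Heaviside function), and $\varepsilon_{n,a}(x-\xi,b(t,\tau)):=\varepsilon_n(x-\xi,a_1(t)-a_1(\tau))$. $dS_\xi$ is the surface element on $\partial\Omega$. For $x\in\partial\Omega$ the integral is improper and defined as $\lim_{h\to0}\int_0^{t-h}\int_{\partial\Omega}$. *)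

theory Defs
  imports "HOL-Analysis.Analysis"
begin

text \<open>
  The surface element on a hypersurface is taken to be the Hausdorff measure of codimension one,
  normalised (by the factor \<^term>\<open>unit_ball_vol\<close>) so that on a \<open>C\<^sup>1\<close> graph it equals
  \<open>\<surd>(1 + |\<nabla>\<gamma>|\<^sup>2) dy\<close>.
  The empty set is singled out because \<^term>\<open>0 ^ 0 = 1\<close>; unbounded covering sets
  are excluded because \<^const>\<open>diameter\<close> is meaningful for bounded sets only.
\<close>

definition hausdorff_weight :: "nat \<Rightarrow> 'a::metric_space set \<Rightarrow> ennreal" where
  "hausdorff_weight k C =
     (if C = {} then 0 else ennreal (unit_ball_vol (real k) * (diameter C / 2) ^ k))"

definition hausdorff_content :: "nat \<Rightarrow> real \<Rightarrow> 'a::metric_space set \<Rightarrow> ennreal" where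
  "hausdorff_content k \<delta> A =
     (INF C \<in> {C :: nat \<Rightarrow> 'a set. A \<subseteq> (\<Union>i. C i) \<and> (\<forall>i. bounded (C i) \<and> diameter (C i) \<le> \<delta>)}.
        \<Sum>i. hausdorff_weight k (C i))"

definition hausdorff_outer :: "nat \<Rightarrow> 'a::metric_space set \<Rightarrow> ennreal" where
  "hausdorff_outer k A = (SUP \<delta>\<in>{0<..}. hausdorff_content k \<delta> A)"

definition hausdorff_measure :: "nat \<Rightarrow> 'a::metric_space measure" where
  "hausdorff_measure k = measure_of UNIV (sets borel) (hausdorff_outer k)"

text \<open>
  \<^const>\<open>measure_of\<close> yields the zero measure unless the given set function is countably additive;
  Caratheodory's criterion, concluding in \<open>emeasure_hausdorff_measure\<close>, shows that it is.
\<close>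

lemma hausdorff_content_empty: assumes "0 \<le> \<delta>" shows "hausdorff_content k \<delta> ({} :: 'a::metric_space set) = 0"
proof -
  have "hausdorff_content k \<delta> ({} :: 'a set) \<le> (\<Sum>i::nat. hausdorff_weight k ({} :: 'a set))"
    unfolding hausdorff_content_def using assms
    by (intro INF_lower2[where i="\<lambda>_. {}"]) auto
  then show ?thesis by (simp add: hausdorff_weight_def)
qed

lemma hausdorff_content_mono: "A \<subseteq> B \<Longrightarrow> hausdorff_content k \<delta> A \<le> hausdorff_content k \<delta> B"
  unfolding hausdorff_content_def by (rule INF_superset_mono) auto

lemma hausdorff_content_antimono:
  "\<delta> \<le> \<delta>' \<Longrightarrow> hausdorff_content k \<delta>' A \<le> hausdorff_content k \<delta> A"
  unfolding hausdorff_content_def by (rule INF_superset_mono) (auto intro: order_trans)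

lemma hausdorff_content_UN:
  "hausdorff_content k \<delta> (\<Union>i::nat. A i) \<le> (\<Sum>i. hausdorff_content k \<delta> (A i))"
proof (rule ennreal_le_epsilon)
  fix e :: real assume fin: "(\<Sum>i. hausdorff_content k \<delta> (A i)) < top" and e: "0 < e"
  let ?P = "\<lambda>i C. A i \<subseteq> (\<Union>j::nat. C j) \<and> (\<forall>j. bounded (C j) \<and> diameter (C j) \<le> \<delta>)"
  have "\<exists>C. ?P i C \<and> (\<Sum>j. hausdorff_weight k (C j)) \<le>
      hausdorff_content k \<delta> (A i) + ennreal (e * (1/2)^Suc i)" for i
  proof -
    have "hausdorff_content k \<delta> (A i) \<noteq> top"
      using fin ennreal_suminf_lessD by (metis less_irrefl)
    then have "hausdorff_content k \<delta> (A i) < hausdorff_content k \<delta> (A i) + ennreal (e * (1/2)^Suc i)"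
      using e ennreal_add_left_cancel_less[of "hausdorff_content k \<delta> (A i)" 0] by (simp add: less_top)
    then show ?thesis
      unfolding hausdorff_content_def INF_less_iff by (auto intro: less_imp_le)
  qed
  then obtain C where C: "\<And>i. ?P i (C i)"
    and le: "\<And>i. (\<Sum>j. hausdorff_weight k (C i j)) \<le>
      hausdorff_content k \<delta> (A i) + ennreal (e * (1/2)^Suc i)" by metis
  let ?D = "\<lambda>n. case prod_decode n of (i, j) \<Rightarrow> C i j"
  have "hausdorff_content k \<delta> (\<Union>i. A i) \<le> (\<Sum>n. hausdorff_weight k (?D n))"
    unfolding hausdorff_content_def
  proof (rule INF_lower, safe)
    fix x i assume "x \<in> A i"
    then obtain j where "x \<in> C i j" using C by blast
    then show "x \<in> (\<Union>n. ?D n)" by (intro UN_I[of "prod_encode (i,j)"]) auto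
  next
    fix n show "bounded (?D n)" "diameter (?D n) \<le> \<delta>" using C by (auto split: prod.split)
  qed
  also have "\<dots> = (\<Sum>i. \<Sum>j. hausdorff_weight k (C i j))"
    using suminf_ennreal_2dimen[of "\<lambda>i. \<Sum>j. hausdorff_weight k (C i j)"
        "\<lambda>(i,j). hausdorff_weight k (C i j)"]
    by (simp add: comp_def split_def)
  also have "\<dots> \<le> (\<Sum>i. hausdorff_content k \<delta> (A i) + ennreal (e * (1/2)^Suc i))"
    by (intro suminf_le le) auto
  also have "\<dots> = (\<Sum>i. hausdorff_content k \<delta> (A i)) + (\<Sum>i. ennreal (e * (1/2)^Suc i))"
    by (rule suminf_add[symmetric]) auto
  also have "(\<Sum>i. ennreal (e * (1/2)^Suc i)) = ennreal e"
    using e sums_mult[OF power_half_series, of e]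
    by (intro suminf_ennreal_eq) auto
  finally show "hausdorff_content k \<delta> (\<Union>i. A i) \<le> (\<Sum>i. hausdorff_content k \<delta> (A i)) + ennreal e" .
qed

lemma hausdorff_content_le_outer: "0 < \<delta> \<Longrightarrow> hausdorff_content k \<delta> A \<le> hausdorff_outer k A"
  unfolding hausdorff_outer_def by (rule SUP_upper) auto

lemma hausdorff_outer_mono: "A \<subseteq> B \<Longrightarrow> hausdorff_outer k A \<le> hausdorff_outer k B"
  unfolding hausdorff_outer_def by (intro SUP_mono) (auto intro: hausdorff_content_mono)

lemma hausdorff_outer_empty: "hausdorff_outer k {} = 0"
  unfolding hausdorff_outer_def by (auto simp: hausdorff_content_empty intro!: SUP_eqI)

lemma hausdorff_outer_UN: "hausdorff_outer k (\<Union>i::nat. A i) \<le> (\<Sum>i. hausdorff_outer k (A i))"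
  unfolding hausdorff_outer_def[of k "\<Union>i. A i"]
proof (rule SUP_least)
  fix \<delta> :: real assume "\<delta> \<in> {0<..}"
  then show "hausdorff_content k \<delta> (\<Union>i. A i) \<le> (\<Sum>i. hausdorff_outer k (A i))"
    by (intro order_trans[OF hausdorff_content_UN] suminf_le hausdorff_content_le_outer) auto
qed

lemma outer_measure_space_hausdorff: "outer_measure_space UNIV (hausdorff_outer k)"
  unfolding outer_measure_space_def positive_def increasing_def countably_subadditive_def
  by (auto simp: hausdorff_outer_empty hausdorff_outer_mono hausdorff_outer_UN)

lemma hausdorff_outer_Un: "hausdorff_outer k (A \<union> B) \<le> hausdorff_outer k A + hausdorff_outer k B"
proof -
  have "subadditive UNIV (hausdorff_outer k :: 'a set \<Rightarrow> ennreal)"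
    using outer_measure_space_hausdorff[of k] ring_of_sets.countably_subadditive_subadditive[of UNIV UNIV]
    by (metis outer_measure_space_def Pow_UNIV algebra_Pow algebra.axioms(1) ring_of_sets_Pow)
  then have "hausdorff_outer k (A \<union> (B - A)) \<le> hausdorff_outer k A + hausdorff_outer k (B - A)"
    by (rule subadditiveD) auto
  then show ?thesis
    using hausdorff_outer_mono[of "B - A" B k] by (metis Un_Diff_cancel Diff_subset add_left_mono order_trans)
qed

lemma hausdorff_outer_separated:
  fixes A B :: "'a::metric_space set"
  assumes e: "0 < e" and d: "\<And>x y. x \<in> A \<Longrightarrow> y \<in> B \<Longrightarrow> e \<le> dist x y"
  shows "hausdorff_outer k A + hausdorff_outer k B \<le> hausdorff_outer k (A \<union> B)"
proof -
  have key: "hausdorff_content k \<delta> A + hausdorff_content k \<delta> B \<le> hausdorff_content k \<delta> (A \<union> B)"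
    if \<delta>: "0 < \<delta>" "\<delta> < e" for \<delta>
    unfolding hausdorff_content_def[of k \<delta> "A \<union> B"]
  proof (rule INF_greatest, safe)
    fix C :: "nat \<Rightarrow> 'a set"
    assume cov: "A \<union> B \<subseteq> (\<Union>i. C i)" and C: "\<forall>i. bounded (C i) \<and> diameter (C i) \<le> \<delta>"
    let ?CA = "\<lambda>i. if C i \<inter> A = {} then {} else C i"
    let ?CB = "\<lambda>i. if C i \<inter> B = {} then {} else C i"
    have disj: "C i \<inter> A = {} \<or> C i \<inter> B = {}" for i
    proof (rule ccontr)
      assume "\<not> ?thesis"
      then obtain x y where xy: "x \<in> C i" "x \<in> A" "y \<in> C i" "y \<in> B" by auto
      then have "dist x y \<le> \<delta>" using C diameter_bounded_bound by (meson order_trans)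
      then show False using d[of x y] xy \<delta> by auto
    qed
    have "hausdorff_content k \<delta> A \<le> (\<Sum>i. hausdorff_weight k (?CA i))"
      unfolding hausdorff_content_def by (rule INF_lower) (use cov C \<delta> in \<open>fastforce\<close>)
    moreover have "hausdorff_content k \<delta> B \<le> (\<Sum>i. hausdorff_weight k (?CB i))"
      unfolding hausdorff_content_def by (rule INF_lower) (use cov C \<delta> in \<open>fastforce\<close>)
    ultimately have "hausdorff_content k \<delta> A + hausdorff_content k \<delta> B \<le>
        (\<Sum>i. hausdorff_weight k (?CA i)) + (\<Sum>i. hausdorff_weight k (?CB i))"
      by (rule add_mono)
    also have "\<dots> = (\<Sum>i. hausdorff_weight k (?CA i) + hausdorff_weight k (?CB i))"
      by (rule suminf_add) auto
    also have "\<dots> \<le> (\<Sum>i. hausdorff_weight k (C i))"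
    proof (rule suminf_le)
      fix i show "hausdorff_weight k (?CA i) + hausdorff_weight k (?CB i) \<le> hausdorff_weight k (C i)"
        using disj[of i] by (auto simp: hausdorff_weight_def)
    qed auto
    finally show "hausdorff_content k \<delta> A + hausdorff_content k \<delta> B \<le> (\<Sum>i. hausdorff_weight k (C i))" .
  qed
  have "hausdorff_outer k A + hausdorff_outer k B =
     (SUP \<delta>\<in>{0<..}. hausdorff_content k \<delta> A + hausdorff_content k \<delta> B)"
    unfolding hausdorff_outer_def
  proof (rule SUP_add_directed_ennreal[symmetric])
    fix i j :: real assume "i \<in> {0<..}" "j \<in> {0<..}"
    then show "\<exists>l\<in>{0<..}. hausdorff_content k i A + hausdorff_content k j B
        \<le> hausdorff_content k l A + hausdorff_content k l B"
      by (intro bexI[of _ "min i j"] add_mono hausdorff_content_antimono) auto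
  qed
  also have "\<dots> \<le> hausdorff_outer k (A \<union> B)"
  proof (rule SUP_least)
    fix \<delta> :: real assume "\<delta> \<in> {0<..}"
    define \<delta>' where "\<delta>' = min \<delta> (e/2)"
    have \<delta>': "0 < \<delta>'" "\<delta>' < e" "\<delta>' \<le> \<delta>" using \<open>\<delta> \<in> _\<close> e by (auto simp: \<delta>'_def min_def)
    have "hausdorff_content k \<delta> A + hausdorff_content k \<delta> B
        \<le> hausdorff_content k \<delta>' A + hausdorff_content k \<delta>' B"
      using \<delta>' by (intro add_mono hausdorff_content_antimono) auto
    also have "\<dots> \<le> hausdorff_outer k (A \<union> B)"
      using key[OF \<delta>'(1,2)] hausdorff_content_le_outer[OF \<delta>'(1)] by (rule order_trans)
    finally show "hausdorff_content k \<delta> A + hausdorff_content k \<delta> B \<le> hausdorff_outer k (A \<union> B)" .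
  qed
  finally show ?thesis .
qed

lemma hausdorff_outer_separated_sum:
  fixes D :: "nat \<Rightarrow> 'a::metric_space set"
  assumes sep: "\<And>i j. i < j \<Longrightarrow> \<exists>e>0. \<forall>x\<in>D i. \<forall>y\<in>D j. e \<le> dist x y"
  shows "(\<Sum>i<n. hausdorff_outer k (D i)) \<le> hausdorff_outer k (\<Union>i<n. D i)"
proof (induction n)
  case (Suc n)
  have "\<exists>e>0. \<forall>x\<in>\<Union>i<m. D i. \<forall>y\<in>D n. e \<le> dist x y" if "m \<le> n" for m
    using that
  proof (induction m)
    case (Suc m)
    then obtain e where e: "e > 0" "\<forall>x\<in>\<Union>i<m. D i. \<forall>y\<in>D n. e \<le> dist x y" by auto
    obtain e' where e': "e' > 0" "\<forall>x\<in>D m. \<forall>y\<in>D n. e' \<le> dist x y"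
      using sep[of m n] Suc.prems by auto
    show ?case
    proof (intro exI[of _ "min e e'"] conjI ballI)
      show "0 < min e e'" using e(1) e'(1) by simp
      fix x y assume "x \<in> \<Union> (D ` {..<Suc m})" and y: "y \<in> D n"
      then consider "x \<in> \<Union> (D ` {..<m})" | "x \<in> D m" unfolding lessThan_Suc by blast
      then show "min e e' \<le> dist x y"
      proof cases
        case 1
        then have "e \<le> dist x y" using e(2) y by blast
        then show ?thesis by simp
      next
        case 2
        then have "e' \<le> dist x y" using e'(2) y by blast
        then show ?thesis by simp
      qed
    qed
  qed (auto intro: exI[of _ 1])
  then obtain e where "e > 0" "\<forall>x\<in>\<Union>i<n. D i. \<forall>y\<in>D n. e \<le> dist x y" by blast
  then have "hausdorff_outer k (\<Union>i<n. D i) + hausdorff_outer k (D n)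
      \<le> hausdorff_outer k ((\<Union>i<n. D i) \<union> D n)"
    by (intro hausdorff_outer_separated) auto
  then have "(\<Sum>i<n. hausdorff_outer k (D i)) + hausdorff_outer k (D n)
      \<le> hausdorff_outer k ((\<Union>i<n. D i) \<union> D n)"
    by (rule order_trans[OF add_right_mono[OF Suc.IH]])
  then show ?case by (simp add: lessThan_Suc Un_commute add.commute)
qed (simp add: hausdorff_outer_empty)

lemma hausdorff_outer_closed:
  fixes F :: "'a::metric_space set"
  assumes F: "closed F"
  shows "hausdorff_outer k (A \<inter> F) + hausdorff_outer k (A - F) \<le> hausdorff_outer k A"
proof (cases "hausdorff_outer k A = top \<or> F = {}")
  case True
  then show ?thesis by (auto simp: hausdorff_outer_empty)
next
  case False
  let ?\<mu> = "hausdorff_outer k :: 'a set \<Rightarrow> ennreal"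
  define X where "X n = {x\<in>A. inverse (real (Suc n)) \<le> infdist x F}" for n
  define R where "R n = X (Suc n) - X n" for n
  have dist_le: "infdist x F \<le> dist x y + infdist y F" for x y
    using infdist_triangle[of x F y] by (simp add: dist_commute add.commute)
  have R_sep: "\<exists>e>0. \<forall>x\<in>R i. \<forall>y\<in>R j. e \<le> dist x y" if "Suc (Suc i) \<le> j" for i j
  proof (intro exI conjI ballI)
    have "inverse (real (Suc j)) \<le> inverse (real (Suc (Suc (Suc i))))"
      using that by (intro le_imp_inverse_le) auto
    moreover have "inverse (real (Suc (Suc (Suc i)))) < inverse (real (Suc (Suc i)))"
      by (intro less_imp_inverse_less) auto
    ultimately show "0 < inverse (real (Suc (Suc i))) - inverse (real (Suc j))" by linarith
  next
    fix x y assume "x \<in> R i" "y \<in> R j"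
    then have "inverse (real (Suc (Suc i))) \<le> infdist x F" "infdist y F < inverse (real (Suc j))"
      by (auto simp: R_def X_def)
    then show "inverse (real (Suc (Suc i))) - inverse (real (Suc j)) \<le> dist x y"
      using dist_le[of x y] by linarith
  qed
  have RA: "R n \<subseteq> A" for n by (auto simp: R_def X_def)
  have half: "(\<Sum>i. ?\<mu> (R (2 * i + c))) \<le> ?\<mu> A" for c
  proof (rule suminf_le_const)
    fix n
    have "(\<Sum>i<n. ?\<mu> (R (2 * i + c))) \<le> ?\<mu> (\<Union>i<n. R (2 * i + c))"
      by (intro hausdorff_outer_separated_sum R_sep) auto
    also have "\<dots> \<le> ?\<mu> A" using RA by (intro hausdorff_outer_mono) auto
    finally show "(\<Sum>i<n. ?\<mu> (R (2 * i + c))) \<le> ?\<mu> A" .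
  qed auto
  have fin: "(\<Sum>i. ?\<mu> (R i)) < top"
  proof -
    have "(\<Sum>i. ?\<mu> (R i)) \<le> ?\<mu> A + ?\<mu> A"
    proof (rule suminf_le_const)
      fix n
      have "(\<Sum>i<n. ?\<mu> (R i)) \<le> (\<Sum>i<2*n. ?\<mu> (R i))" by (intro sum_mono2) auto
      also have "\<dots> = (\<Sum>i<n. ?\<mu> (R (2 * i + 0))) + (\<Sum>i<n. ?\<mu> (R (2 * i + 1)))"
        by (induction n) (auto simp: algebra_simps)
      also have "\<dots> \<le> ?\<mu> A + ?\<mu> A"
        by (intro add_mono order_trans[OF sum_le_suminf half]) auto
      finally show "(\<Sum>i<n. ?\<mu> (R i)) \<le> ?\<mu> A + ?\<mu> A" .
    qed auto
    also have "\<dots> < top" using False by (simp add: less_top)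
    finally show ?thesis .
  qed
  have cover: "A - F \<subseteq> X n \<union> (\<Union>i. R (i + n))" for n
  proof
    fix x assume x: "x \<in> A - F"
    then have "0 < infdist x F"
      using F False by (metis DiffD2 in_closed_iff_infdist_zero infdist_nonneg less_eq_real_def)
    then obtain m where "inverse (real (Suc m)) < infdist x F" using reals_Archimedean by blast
    then have ex: "\<exists>m. x \<in> X m" using x by (auto simp: X_def intro: less_imp_le)
    define m where "m = (LEAST m. x \<in> X m)"
    have m: "x \<in> X m" and least: "\<And>j. j < m \<Longrightarrow> x \<notin> X j"
      using ex by (auto simp: m_def intro: LeastI_ex dest: not_less_Least)
    show "x \<in> X n \<union> (\<Union>i. R (i + n))"
    proof (cases "m \<le> n")
      case True
      have "inverse (real (Suc n)) \<le> inverse (real (Suc m))" using True by (intro le_imp_inverse_le) auto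
      then have "x \<in> X n" using m order_trans unfolding X_def by blast
      then show ?thesis by simp
    next
      case False
      then obtain j where j: "m = Suc (j + n)" by (metis add.commute less_imp_Suc_add not_le)
      then have "x \<in> R (j + n)" using m least[of "j + n"] by (auto simp: R_def)
      then show ?thesis by blast
    qed
  qed
  have bound: "?\<mu> (A \<inter> F) + ?\<mu> (A - F) \<le> ?\<mu> A + (\<Sum>i. ?\<mu> (R (i + n)))" for n
  proof -
    have "?\<mu> (A - F) \<le> ?\<mu> (X n) + ?\<mu> (\<Union>i. R (i + n))"
      using hausdorff_outer_mono[OF cover] hausdorff_outer_Un by (rule order_trans)
    also have "\<dots> \<le> ?\<mu> (X n) + (\<Sum>i. ?\<mu> (R (i + n)))"
      by (intro add_left_mono hausdorff_outer_UN)
    finally have 1: "?\<mu> (A - F) \<le> ?\<mu> (X n) + (\<Sum>i. ?\<mu> (R (i + n)))" .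
    have "?\<mu> (A \<inter> F) + ?\<mu> (X n) \<le> ?\<mu> (A \<inter> F \<union> X n)"
    proof (rule hausdorff_outer_separated)
      show "0 < inverse (real (Suc n))" by simp
      fix x y assume "x \<in> A \<inter> F" "y \<in> X n"
      then show "inverse (real (Suc n)) \<le> dist x y"
        using infdist_le[of x F y] by (auto simp: X_def dist_commute)
    qed
    also have "\<dots> \<le> ?\<mu> A" by (intro hausdorff_outer_mono) (auto simp: X_def)
    finally have 2: "?\<mu> (A \<inter> F) + ?\<mu> (X n) \<le> ?\<mu> A" .
    have "?\<mu> (A \<inter> F) + ?\<mu> (A - F) \<le> ?\<mu> (A \<inter> F) + (?\<mu> (X n) + (\<Sum>i. ?\<mu> (R (i + n))))"
      by (intro add_left_mono 1)
    also have "\<dots> = (?\<mu> (A \<inter> F) + ?\<mu> (X n)) + (\<Sum>i. ?\<mu> (R (i + n)))" by (rule add.assoc[symmetric])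
    also have "\<dots> \<le> ?\<mu> A + (\<Sum>i. ?\<mu> (R (i + n)))" by (intro add_right_mono 2)
    finally show ?thesis .
  qed
  show ?thesis
  proof (rule ennreal_le_epsilon)
    fix e :: real assume e: "0 < e"
    have rfin: "?\<mu> (R i) < top" for i using fin by (rule ennreal_suminf_lessD)
    define r where "r i = enn2real (?\<mu> (R i))" for i
    have r: "0 \<le> r i" "?\<mu> (R i) = ennreal (r i)" for i
      using rfin[of i] by (simp_all add: r_def)
    have "summable r"
      using fin r by (intro summable_suminf_not_top) auto
    then obtain n where n: "norm (\<Sum>i. r (i + n)) < e"
      using suminf_exist_split[OF e] by blast
    have "(\<Sum>i. ?\<mu> (R (i + n))) = ennreal (\<Sum>i. r (i + n))"
      unfolding r(2) using \<open>summable r\<close> r(1) summable_ignore_initial_segment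
      by (intro suminf_ennreal2) auto
    also have "\<dots> \<le> ennreal e" using n by (intro ennreal_leI) auto
    finally show "?\<mu> (A \<inter> F) + ?\<mu> (A - F) \<le> ?\<mu> A + ennreal e"
      by (rule order_trans[OF bound[of n] add_left_mono])
  qed
qed

lemma measure_space_hausdorff:
  "measure_space UNIV (sets (borel :: 'a::metric_space measure)) (hausdorff_outer k)"
proof -
  let ?L = "lambda_system UNIV UNIV (hausdorff_outer k :: 'a set \<Rightarrow> ennreal)"
  have sa: "sigma_algebra UNIV (UNIV :: 'a set set)" using sigma_algebra_Pow[of "UNIV::'a set"] by simp
  have ms: "measure_space UNIV ?L (hausdorff_outer k)"
    by (rule sigma_algebra.caratheodory_lemma[OF sa outer_measure_space_hausdorff])
  have "{F :: 'a set. closed F} \<subseteq> ?L"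
  proof safe
    fix F :: "'a set" assume "closed F"
    then have "hausdorff_outer k (x \<inter> F) + hausdorff_outer k (x - F) = hausdorff_outer k x" for x
      using hausdorff_outer_closed[of F k x] hausdorff_outer_Un[of k "x \<inter> F" "x - F"]
      by (intro order_antisym) (simp_all add: Int_Diff_Un)
    then show "F \<in> ?L"
      by (auto simp: lambda_system_def Int_commute Diff_eq)
  qed
  then have "sets (borel :: 'a measure) \<subseteq> ?L"
    using ms sigma_algebra.sigma_sets_subset[of UNIV ?L "Collect closed"]
    unfolding borel_eq_closed measure_space_def by simp
  then show ?thesis
    using ms unfolding measure_space_def
    using sets.sigma_algebra_axioms[of "borel :: 'a measure"]
    by (auto simp: positive_def countably_additive_def subset_eq)
qed

lemma emeasure_hausdorff_measure:
  "A \<in> sets borel \<Longrightarrow> emeasure (hausdorff_measure k) A = hausdorff_outer k A"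
  using measure_space_hausdorff[of k] unfolding hausdorff_measure_def measure_space_def
  by (intro emeasure_measure_of_sigma) (auto simp: sigma_algebra.sigma_sets_eq)

definition surface_measure :: "'a::euclidean_space set \<Rightarrow> 'a measure" where
  "surface_measure \<Omega> =
     completion (restrict_space (hausdorff_measure (DIM('a) - 1)) (frontier \<Omega>))"

text \<open>
  The boundary is of class \<open>C\<^bsup>1+lam\<^esup>\<close>: near each boundary point \<open>p\<close>, in suitable orthonormal
  coordinates \<open>x = y + s \<nu>\<close> with \<open>y \<bottom> \<nu>\<close>, the domain is the part \<open>s > \<gamma> y\<close> above the graph
  of a function \<open>\<gamma>\<close> of \<open>n - 1\<close> variables whose gradient is Hoelder continuous with exponent \<open>lam\<close>.
  Only the values of \<open>\<gamma>\<close> on the hyperplane orthogonal to \<open>\<nu>\<close> matter.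
\<close>

definition C1_holder_on :: "real \<Rightarrow> 'a::euclidean_space set \<Rightarrow> ('a \<Rightarrow> real) \<Rightarrow> bool" where
  "C1_holder_on lam H \<gamma> \<longleftrightarrow>
     (\<exists>G K. (\<forall>y\<in>H. (\<gamma> has_derivative (\<lambda>v. G y \<bullet> v)) (at y within H)) \<and>
            (\<forall>y\<in>H. \<forall>z\<in>H. norm (G y - G z) \<le> K * dist y z powr lam))"

definition hyperplane_proj :: "'a::euclidean_space \<Rightarrow> 'a \<Rightarrow> 'a" where
  "hyperplane_proj \<nu> x = x - (x \<bullet> \<nu>) *\<^sub>R \<nu>"

definition C1_holder_boundary :: "real \<Rightarrow> 'a::euclidean_space set \<Rightarrow> bool" where
  "C1_holder_boundary lam \<Omega> \<longleftrightarrow>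
     (\<forall>p\<in>frontier \<Omega>. \<exists>\<nu> r \<gamma>. norm \<nu> = 1 \<and> r > 0 \<and>
        C1_holder_on lam ({y. y \<bullet> \<nu> = 0} \<inter> ball (hyperplane_proj \<nu> p) r) \<gamma> \<and>
        \<Omega> \<inter> ball p r = {x \<in> ball p r. x \<bullet> \<nu> > \<gamma> (hyperplane_proj \<nu> x)})"

definition coeff_prim :: "(real \<Rightarrow> real) \<Rightarrow> real \<Rightarrow> real" where
  "coeff_prim a t = (LINT z:{0..t}|lebesgue. a z)"

definition coeff_int :: "(real \<Rightarrow> real) \<Rightarrow> real \<Rightarrow> real \<Rightarrow> real" where
  "coeff_int a t \<tau> = coeff_prim a t - coeff_prim a \<tau>"

definition heat_kernel :: "'a::euclidean_space \<Rightarrow> real \<Rightarrow> real" where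
  "heat_kernel x t =
     (if t > 0 then (4 * pi * t) powr (- (real DIM('a) / 2)) * exp (- (norm x)\<^sup>2 / (4 * t)) else 0)"

definition layer_integrand ::
  "(real \<Rightarrow> real) \<Rightarrow> ('a::euclidean_space \<Rightarrow> real \<Rightarrow> real) \<Rightarrow> 'a \<Rightarrow> real \<Rightarrow> real \<Rightarrow> 'a \<Rightarrow> real" where
  "layer_integrand a \<phi> x t \<tau> \<xi> = heat_kernel (x - \<xi>) (coeff_int a t \<tau>) * \<phi> \<xi> \<tau> * a \<tau>"

text \<open>Integration over \<open>0 \<le> \<tau> \<le> s\<close> only, where \<open>s \<le> t\<close>.\<close>

definition single_layer_upto ::
  "(real \<Rightarrow> real) \<Rightarrow> 'a::euclidean_space set \<Rightarrow> ('a \<Rightarrow> real \<Rightarrow> real) \<Rightarrow> 'a \<Rightarrow> real \<Rightarrow> real \<Rightarrow> real" where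
  "single_layer_upto a \<Omega> \<phi> x t s =
     (LINT \<tau>:{0..s}|lebesgue. (LINT \<xi>|surface_measure \<Omega>. layer_integrand a \<phi> x t \<tau> \<xi>))"

definition single_layer_integrable_upto ::
  "(real \<Rightarrow> real) \<Rightarrow> 'a::euclidean_space set \<Rightarrow> ('a \<Rightarrow> real \<Rightarrow> real) \<Rightarrow> 'a \<Rightarrow> real \<Rightarrow> real \<Rightarrow> bool" where
  "single_layer_integrable_upto a \<Omega> \<phi> x t s \<longleftrightarrow>
     (AE \<tau> in lebesgue_on {0..s}. integrable (surface_measure \<Omega>) (layer_integrand a \<phi> x t \<tau>)) \<and>
     set_integrable lebesgue {0..s}
       (\<lambda>\<tau>. LINT \<xi>|surface_measure \<Omega>. layer_integrand a \<phi> x t \<tau> \<xi>)"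

definition single_layer ::
  "(real \<Rightarrow> real) \<Rightarrow> 'a::euclidean_space set \<Rightarrow> ('a \<Rightarrow> real \<Rightarrow> real) \<Rightarrow> 'a \<Rightarrow> real \<Rightarrow> real" where
  "single_layer a \<Omega> \<phi> x t =
     (if x \<in> frontier \<Omega>
      then Lim (at_right 0) (\<lambda>h. single_layer_upto a \<Omega> \<phi> x t (t - h))
      else single_layer_upto a \<Omega> \<phi> x t t)"

text \<open>
  Since \<^const>\<open>lebesgue_integral\<close> and \<^const>\<open>Lim\<close> are total, existence of the (improper)
  integral has to be expressed separately.
\<close>

definition single_layer_exists ::
  "(real \<Rightarrow> real) \<Rightarrow> 'a::euclidean_space set \<Rightarrow> ('a \<Rightarrow> real \<Rightarrow> real) \<Rightarrow> 'a \<Rightarrow> real \<Rightarrow> bool" where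
  "single_layer_exists a \<Omega> \<phi> x t \<longleftrightarrow>
     (if x \<in> frontier \<Omega>
      then (\<forall>h\<in>{0<..<t}. single_layer_integrable_upto a \<Omega> \<phi> x t (t - h)) \<and>
           (\<exists>l. ((\<lambda>h. single_layer_upto a \<Omega> \<phi> x t (t - h)) \<longlongrightarrow> l) (at_right 0))
      else single_layer_integrable_upto a \<Omega> \<phi> x t t)"

end

theory Submission
  imports Defs
begin

text \<open>
  The singularity of the heat kernel is integrable for two independent reasons, one in space and one
  in time, and neither depends on the position of \<open>x\<close> relative to the boundary.

  In space, only the size of the surface measure \<open>\<sigma>\<close> near a point matters. A \<open>C\<^sup>1\<close> hypersurface is
  locally a Lipschitz graph, and covering such a graph by the pieces over a grid of small cubes gives
  \<open>\<sigma>(B(x,\<rho>)) \<le> c \<rho>\<^bsup>n-1\<^esup>\<close> for all centres \<open>x\<close> of the whole space and all radii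
  (\<open>surface_measure_growth\<close>). Summing the Gaussian over shells around \<open>x\<close> of width \<open>\<surd>s\<close> turns this into
  \<open>\<integral> \<epsilon>\<^sub>n(x - \<xi>, s) d\<sigma>(\<xi>) \<le> C / \<surd>s\<close>, uniformly in \<open>x\<close> (\<open>heat_kernel_surface_integral_le\<close>).

  In time, the measure \<open>a(\<tau>) d\<tau>\<close> of the set where \<open>0 < b(t,\<tau>) \<le> \<beta>\<close> is at most \<open>\<beta>\<close>, because
  that set lies in an interval ending at \<open>t\<close> over which \<open>a\<close> integrates to at most \<open>\<beta>\<close>. This stands in
  for the substitution \<open>s = b(t,\<tau>)\<close>, and a dyadic decomposition of the values of \<open>b\<close> yields
  \<open>\<integral> b(t,\<tau>)\<^bsup>-1/2\<^esup> a(\<tau>) d\<tau> \<le> 4 \<surd>\<beta>\<close> over that set (\<open>inverse_sqrt_coeff_integral_le\<close>).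

  Together, the part of the potential that comes from times with \<open>b(t,\<tau>) \<le> \<beta>\<close> is \<open>O(\<surd>\<beta>)\<close>, uniformly in
  \<open>(x,t)\<close>. The heat kernel multiplied by a continuous cutoff that vanishes for \<open>b \<le> \<beta>\<close> is
  bounded and continuous, so its potential is continuous by dominated convergence
  (\<open>potential_continuous\<close>). The single layer potential is the uniform limit of these as \<open>\<beta> \<rightarrow> 0\<close>
  (\<open>potential_cut_approx\<close>), hence continuous, on the boundary as well as off it.

  On the boundary the improper integral agrees with the ordinary one, since the integrand is
  absolutely integrable up to \<open>\<tau> = t\<close>. The density is measurable only for a completed product
  measure; replacing it by a bounded product-measurable function that equals it almost everywhere changes the
  inner integrals for a null set of times \<open>\<tau>\<close> only.
\<close>

section \<open>Growth of the surface measure\<close>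

lemma hausdorff_content_finite_cover:
  fixes C :: "'i \<Rightarrow> 'a::metric_space set"
  assumes "finite I" "0 \<le> \<delta>" "A \<subseteq> (\<Union>i\<in>I. C i)"
    and C: "\<And>i. i \<in> I \<Longrightarrow> bounded (C i) \<and> diameter (C i) \<le> \<delta>"
  shows "hausdorff_content k \<delta> A \<le> (\<Sum>i\<in>I. hausdorff_weight k (C i))"
proof -
  obtain h where h: "bij_betw h {0..<card I} I"
    using ex_bij_betw_nat_finite[OF assms(1)] by blast
  define D where "D n = (if n < card I then C (h n) else {})" for n
  have hI: "h n \<in> I" if "n < card I" for n
    using h that by (auto simp: bij_betw_def)
  have "A \<subseteq> (\<Union>n. D n)"
  proof
    fix x assume "x \<in> A"
    then obtain i where i: "i \<in> I" "x \<in> C i" using assms(3) by blast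
    then obtain n where "n < card I" "h n = i"
      using h unfolding bij_betw_def by (metis atLeastLessThan_iff imageE)
    then have "x \<in> D n" using i by (simp add: D_def)
    then show "x \<in> (\<Union>n. D n)" by blast
  qed
  then have "hausdorff_content k \<delta> A \<le> (\<Sum>n. hausdorff_weight k (D n))"
    unfolding hausdorff_content_def
    using C hI assms(2) by (intro INF_lower) (auto simp: D_def)
  also have "\<dots> = (\<Sum>n\<in>{0..<card I}. hausdorff_weight k (D n))"
    by (rule suminf_finite) (auto simp: D_def hausdorff_weight_def)
  also have "\<dots> = (\<Sum>n\<in>{0..<card I}. hausdorff_weight k (C (h n)))"
    by (intro sum.cong) (auto simp: D_def)
  also have "\<dots> = (\<Sum>i\<in>I. hausdorff_weight k (C i))"
    by (rule sum.reindex_bij_betw[OF h])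
  finally show ?thesis .
qed

text \<open>
  The grid below is aligned with an orthonormal basis of a hyperplane, so distances have to be
  controlled by the coordinates in that basis.
\<close>

lemma norm_le_sum_orthonormal:
  fixes v :: "'a::euclidean_space"
  assumes "pairwise orthogonal B" "\<And>x. x \<in> B \<Longrightarrow> norm x = 1" "finite B" "v \<in> span B"
  shows "norm v \<le> (\<Sum>b\<in>B. \<bar>v \<bullet> b\<bar>)"
proof -
  have "v = (\<Sum>b\<in>B. (v \<bullet> b) *\<^sub>R b)"
    using orthonormal_basis_expand[OF assms(1,2,4,3)] by simp
  then have "norm v \<le> (\<Sum>b\<in>B. norm ((v \<bullet> b) *\<^sub>R b))"
    by (metis norm_sum)
  then show ?thesis using assms(2) by simp
qed

lemma hyperplane_proj_in: "norm \<nu> = 1 \<Longrightarrow> hyperplane_proj \<nu> x \<bullet> \<nu> = 0"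
  by (simp add: hyperplane_proj_def inner_diff_left norm_eq_1)

lemma hyperplane_proj_diff:
  "hyperplane_proj \<nu> x - hyperplane_proj \<nu> y = hyperplane_proj \<nu> (x - y)"
  by (simp add: hyperplane_proj_def inner_diff_left scaleR_diff_left)

lemma norm_hyperplane_proj_le:
  assumes "norm \<nu> = 1" shows "norm (hyperplane_proj \<nu> x) \<le> norm x"
proof -
  have "x = hyperplane_proj \<nu> x + (x \<bullet> \<nu>) *\<^sub>R \<nu>" by (simp add: hyperplane_proj_def)
  moreover have "orthogonal (hyperplane_proj \<nu> x) ((x \<bullet> \<nu>) *\<^sub>R \<nu>)"
    using hyperplane_proj_in[OF assms] by (simp add: orthogonal_def)
  ultimately have "(norm x)\<^sup>2 = (norm (hyperplane_proj \<nu> x))\<^sup>2 + (norm ((x \<bullet> \<nu>) *\<^sub>R \<nu>))\<^sup>2"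
    using norm_add_Pythagorean by metis
  then have "(norm (hyperplane_proj \<nu> x))\<^sup>2 \<le> (norm x)\<^sup>2" by simp
  then show ?thesis by (rule power2_le_imp_le) simp
qed

lemma dist_hyperplane_proj_le:
  "norm \<nu> = 1 \<Longrightarrow> dist (hyperplane_proj \<nu> x) (hyperplane_proj \<nu> y) \<le> dist x y"
  unfolding dist_norm hyperplane_proj_diff by (rule norm_hyperplane_proj_le)

text \<open>
  A set on which the projection to a hyperplane has a Lipschitz inverse is cut into the pieces over
  a grid of mesh \<open>\<rho> / m\<close> in that hyperplane. There are \<open>(2 m + 1)\<^sup>k\<close> cells over a ball of radius \<open>\<rho>\<close>,
  and each piece has diameter at most \<open>L k \<rho> / m\<close>, so the powers of \<open>m\<close> in the resulting weight
  cancel up to the factor \<open>3\<^sup>k\<close>. The bound is therefore uniform in \<open>\<delta>\<close>, at the price of a constant that is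
  not sharp.
\<close>

lemma hausdorff_content_graph_le:
  fixes E :: "'a::euclidean_space set" and z \<nu> :: 'a
  defines "k \<equiv> DIM('a) - 1"
  assumes \<nu>: "norm \<nu> = 1" and L: "0 \<le> L" and \<rho>: "0 < \<rho>"
    and Lip: "\<And>x y. x \<in> E \<Longrightarrow> y \<in> E \<Longrightarrow> dist x y \<le> L * dist (hyperplane_proj \<nu> x) (hyperplane_proj \<nu> y)"
    and m: "0 < m" "L * (real k * (\<rho> / real m)) \<le> \<delta>"
  shows "hausdorff_content k \<delta> (E \<inter> cball z \<rho>)
     \<le> ennreal (unit_ball_vol (real k) * (3 * L * real k / 2) ^ k * \<rho> ^ k)"
proof -
  let ?H = "{y. \<nu> \<bullet> y = 0}"
  have "\<nu> \<noteq> 0" using \<nu> by auto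
  have "\<exists>B. B \<subseteq> ?H \<and> pairwise orthogonal B \<and> (\<forall>x\<in>B. norm x = 1)
      \<and> independent B \<and> card B = dim ?H \<and> span B = ?H"
    by (rule orthonormal_basis_subspace[OF subspace_hyperplane[of \<nu>]]) blast
  then obtain B where B: "B \<subseteq> ?H" "pairwise orthogonal B" "\<And>x. x \<in> B \<Longrightarrow> norm x = 1"
    "independent B" "card B = dim ?H" "span B = ?H" by blast
  have finB: "finite B" using B(4) by (rule independent_imp_finite)
  have cardB: "card B = k" using B(5) dim_hyperplane[OF \<open>\<nu> \<noteq> 0\<close>] by (simp add: k_def)
  define d where "d = \<rho> / real m"
  have d: "0 < d" using \<rho> m by (simp add: d_def)
  define I where "I = B \<rightarrow>\<^sub>E {- int m..int m}"
  \<comment> \<open>the part of \<open>E\<close> over the cell with index \<open>f\<close>, cells being indexed by integer coordinates relative to \<open>z\<close>\<close>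
  define C where "C f = {x\<in>E. \<forall>b\<in>B. \<lfloor>((x - z) \<bullet> b) / d\<rfloor> = f b}" for f
  have nat_eq: "nat (2 * int m + 1) = Suc (2 * m)" by simp
  have cardI: "finite I" "card I = (2 * m + 1) ^ k"
    using finB cardB nat_eq by (auto simp: I_def card_PiE finite_PiE)
  define D where "D = L * (real k * d)"
  have D0: "0 \<le> D" using L d by (simp add: D_def)
  \<comment> \<open>coordinates of two points of a cell differ by at most the mesh, being equal after rounding down\<close>
  have Cdist: "dist x y \<le> D" if x: "x \<in> C f" and y: "y \<in> C f" for f x y
  proof -
    let ?v = "hyperplane_proj \<nu> (x - y)"
    have "?v \<in> span B" using hyperplane_proj_in[OF \<nu>] B(6) by (auto simp: inner_commute)
    then have "norm ?v \<le> (\<Sum>b\<in>B. \<bar>?v \<bullet> b\<bar>)"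
      by (intro norm_le_sum_orthonormal B finB)
    also have "\<dots> \<le> (\<Sum>b\<in>B. d)"
    proof (rule sum_mono)
      fix b assume b: "b \<in> B"
      then have "\<nu> \<bullet> b = 0" using B(1) by auto
      then have 1: "?v \<bullet> b = (x - z) \<bullet> b - (y - z) \<bullet> b"
        by (simp add: hyperplane_proj_def inner_diff_left)
      have "\<lfloor>((x - z) \<bullet> b) / d\<rfloor> = \<lfloor>((y - z) \<bullet> b) / d\<rfloor>"
        using x y b by (simp add: C_def)
      then have "\<bar>((x - z) \<bullet> b) / d - ((y - z) \<bullet> b) / d\<bar> \<le> 1" by linarith
      then have "\<bar>((x - z) \<bullet> b - (y - z) \<bullet> b) / d\<bar> \<le> 1" by (simp add: diff_divide_distrib)
      then show "\<bar>?v \<bullet> b\<bar> \<le> d" using d 1 by (simp add: abs_divide)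
    qed
    finally have "norm ?v \<le> real k * d" by (simp add: cardB)
    moreover have "dist x y \<le> L * norm ?v"
      using Lip[of x y] x y by (simp add: C_def dist_norm hyperplane_proj_diff)
    ultimately show ?thesis
      using L mult_left_mono unfolding D_def by (metis order_trans)
  qed
  have Cb: "bounded (C f)" for f
  proof (cases "C f = {}")
    case False
    then obtain x where "x \<in> C f" by blast
    then have "\<forall>y\<in>C f. dist x y \<le> D" using Cdist by blast
    then show ?thesis unfolding bounded_def by blast
  qed simp
  have Cd: "diameter (C f) \<le> D" for f
    by (rule diameter_le) (use D0 Cdist in \<open>auto simp: dist_norm\<close>)
  have cover: "E \<inter> cball z \<rho> \<subseteq> (\<Union>f\<in>I. C f)"
  proof
    fix x assume x: "x \<in> E \<inter> cball z \<rho>"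
    define f where "f = restrict (\<lambda>b. \<lfloor>((x - z) \<bullet> b) / d\<rfloor>) B"
    have "\<lfloor>((x - z) \<bullet> b) / d\<rfloor> \<in> {- int m..int m}" if b: "b \<in> B" for b
    proof -
      have "\<bar>(x - z) \<bullet> b\<bar> \<le> norm (x - z) * norm b" by (rule Cauchy_Schwarz_ineq2)
      also have "\<dots> \<le> \<rho>" using x B(3)[OF b] by (simp add: dist_norm norm_minus_commute)
      finally have "\<bar>(x - z) \<bullet> b\<bar> / d \<le> \<rho> / d" using d by (intro divide_right_mono) auto
      moreover have "\<rho> / d = real m" using \<rho> m by (simp add: d_def)
      ultimately have "\<bar>((x - z) \<bullet> b) / d\<bar> \<le> real m" using d by (simp add: abs_divide)
      then have "- real m \<le> ((x - z) \<bullet> b) / d" "((x - z) \<bullet> b) / d < real m + 1" by linarith+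
      then show ?thesis by (simp add: le_floor_iff floor_le_iff)
    qed
    then have "f \<in> I" "x \<in> C f" using x by (auto simp: f_def I_def C_def)
    then show "x \<in> (\<Union>f\<in>I. C f)" by blast
  qed
  have w: "hausdorff_weight k (C f) \<le> ennreal (unit_ball_vol (real k) * (D / 2) ^ k)" for f
    using Cd[of f] diameter_ge_0[OF Cb, of f]
    by (auto simp: hausdorff_weight_def intro!: ennreal_leI mult_left_mono power_mono)
  have "hausdorff_content k \<delta> (E \<inter> cball z \<rho>) \<le> (\<Sum>f\<in>I. hausdorff_weight k (C f))"
    using cover cardI Cb Cd m D0 by (intro hausdorff_content_finite_cover) (auto simp: D_def d_def intro: order_trans)
  also have "\<dots> \<le> (\<Sum>f\<in>I. ennreal (unit_ball_vol (real k) * (D / 2) ^ k))"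
    by (intro sum_mono w)
  also have "\<dots> = ennreal (real ((2 * m + 1) ^ k) * (unit_ball_vol (real k) * (D / 2) ^ k))"
    using cardI D0 by (simp add: ennreal_mult ennreal_of_nat_eq_real_of_nat)
  also have "\<dots> \<le> ennreal (unit_ball_vol (real k) * (3 * L * real k / 2) ^ k * \<rho> ^ k)"
  proof (rule ennreal_leI)
    have "real ((2 * m + 1) ^ k) * (D / 2) ^ k = (real (2 * m + 1) * (D / 2)) ^ k"
      by (simp only: power_mult_distrib of_nat_power)
    also have "\<dots> \<le> (real (3 * m) * (D / 2)) ^ k"
      using m D0 by (intro power_mono mult_right_mono) auto
    also have "real (3 * m) * (D / 2) = (3 * L * real k / 2) * \<rho>"
      using m by (simp add: D_def d_def)
    finally have "real ((2 * m + 1) ^ k) * (D / 2) ^ k \<le> (3 * L * real k / 2) ^ k * \<rho> ^ k"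
      by (simp only: power_mult_distrib)
    then have "unit_ball_vol (real k) * (real ((2 * m + 1) ^ k) * (D / 2) ^ k)
        \<le> unit_ball_vol (real k) * ((3 * L * real k / 2) ^ k * \<rho> ^ k)"
      by (rule mult_left_mono) simp
    then show "real ((2 * m + 1) ^ k) * (unit_ball_vol (real k) * (D / 2) ^ k)
        \<le> unit_ball_vol (real k) * (3 * L * real k / 2) ^ k * \<rho> ^ k"
      by (simp add: mult_ac)
  qed
  finally show ?thesis .
qed

lemma hausdorff_outer_graph_le:
  fixes E :: "'a::euclidean_space set" and z \<nu> :: 'a
  defines "k \<equiv> DIM('a) - 1"
  assumes \<nu>: "norm \<nu> = 1" and L: "0 \<le> L" and \<rho>: "0 < \<rho>"
    and Lip: "\<And>x y. x \<in> E \<Longrightarrow> y \<in> E \<Longrightarrow> dist x y \<le> L * dist (hyperplane_proj \<nu> x) (hyperplane_proj \<nu> y)"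
  shows "hausdorff_outer k (E \<inter> cball z \<rho>)
     \<le> ennreal (unit_ball_vol (real k) * (3 * L * real k / 2) ^ k * \<rho> ^ k)"
  unfolding hausdorff_outer_def
proof (rule SUP_least)
  fix \<delta> :: real assume "\<delta> \<in> {0<..}"
  then have \<delta>: "0 < \<delta>" by simp
  \<comment> \<open>the mesh is chosen so fine that the pieces are admissible for \<open>\<delta>\<close>\<close>
  obtain m :: nat where m: "L * real k * \<rho> / \<delta> < real m" using reals_Archimedean2 by blast
  have "0 \<le> L * real k * \<rho> / \<delta>" using L \<rho> \<delta> by simp
  then have m0: "0 < m" using m by linarith
  have "L * (real k * (\<rho> / real m)) \<le> \<delta>" using m m0 \<delta> by (simp add: field_simps)
  then show "hausdorff_content k \<delta> (E \<inter> cball z \<rho>)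
     \<le> ennreal (unit_ball_vol (real k) * (3 * L * real k / 2) ^ k * \<rho> ^ k)"
    using hausdorff_content_graph_le[OF \<nu> L \<rho> Lip m0] unfolding k_def by blast
qed

lemma C1_holder_on_lipschitz:
  fixes \<gamma> :: "'a::euclidean_space \<Rightarrow> real"
  assumes "C1_holder_on lam S \<gamma>" "convex S" "bounded S" "0 \<le> lam"
  shows "\<exists>L\<ge>0. \<forall>y\<in>S. \<forall>z\<in>S. \<bar>\<gamma> y - \<gamma> z\<bar> \<le> L * dist y z"
proof (cases "S = {}")
  case False
  then obtain q where q: "q \<in> S" by blast
  obtain G K where G: "\<And>y. y\<in>S \<Longrightarrow> (\<gamma> has_derivative (\<lambda>v. G y \<bullet> v)) (at y within S)"
    and K: "\<And>y z. y\<in>S \<Longrightarrow> z\<in>S \<Longrightarrow> norm (G y - G z) \<le> K * dist y z powr lam"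
    using assms(1) unfolding C1_holder_on_def by blast
  obtain R where R: "\<And>y. y \<in> S \<Longrightarrow> dist q y \<le> R"
    using assms(3) bounded_any_center[of S q] by blast
  \<comment> \<open>the gradient is bounded, being Hoelder continuous on a bounded set\<close>
  define L where "L = norm (G q) + \<bar>K\<bar> * R powr lam"
  have L0: "0 \<le> L" by (simp add: L_def)
  have GL: "norm (G y) \<le> L" if y: "y \<in> S" for y
  proof -
    have "norm (G y) \<le> norm (G q) + norm (G y - G q)" using norm_triangle_sub[of "G y" "G q"] by simp
    moreover have "norm (G y - G q) \<le> \<bar>K\<bar> * dist y q powr lam"
      using K[OF y q] by (rule order_trans) (simp add: mult_right_mono)
    moreover have "\<dots> \<le> \<bar>K\<bar> * R powr lam"
      using R[OF y] assms(4) by (intro mult_left_mono powr_mono2) (auto simp: dist_commute)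
    ultimately show ?thesis by (simp add: L_def)
  qed
  have "norm (\<gamma> y - \<gamma> z) \<le> L * norm (y - z)" if "y \<in> S" "z \<in> S" for y z
  proof (rule differentiable_bound[OF assms(2) _ _ that])
    fix x assume x: "x \<in> S"
    then show "(\<gamma> has_derivative (\<lambda>v. G x \<bullet> v)) (at x within S)" by (rule G)
    show "onorm (\<lambda>v. G x \<bullet> v) \<le> L"
    proof (rule onorm_bound[OF L0])
      fix v
      have "norm (G x \<bullet> v) \<le> norm (G x) * norm v" by (simp add: Cauchy_Schwarz_ineq2)
      also have "\<dots> \<le> L * norm v" using GL[OF x] by (rule mult_right_mono) simp
      finally show "norm (G x \<bullet> v) \<le> L * norm v" .
    qed
  qed
  then show ?thesis using L0 by (auto simp: dist_norm)
qed auto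

text \<open>
  Points strictly above the graph belong to the open set \<open>\<Omega>\<close>, hence not to its frontier. A point of the
  frontier is a limit of points of \<open>\<Omega>\<close>, all above the graph, and as \<open>\<gamma>\<close> is continuous the limit cannot
  lie strictly below.
\<close>

lemma frontier_local_graph:
  fixes \<Omega> :: "'a::euclidean_space set"
  assumes \<Omega>: "open \<Omega>" and \<nu>: "norm \<nu> = 1"
    and eq: "\<Omega> \<inter> ball p r = {x \<in> ball p r. x \<bullet> \<nu> > \<gamma> (hyperplane_proj \<nu> x)}"
    and Lip: "\<And>y z. y \<in> {y. y \<bullet> \<nu> = 0} \<inter> ball (hyperplane_proj \<nu> p) r \<Longrightarrow>
        z \<in> {y. y \<bullet> \<nu> = 0} \<inter> ball (hyperplane_proj \<nu> p) r \<Longrightarrow> \<bar>\<gamma> y - \<gamma> z\<bar> \<le> L * dist y z"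
    and x: "x \<in> frontier \<Omega>" "x \<in> ball p r"
  shows "x \<bullet> \<nu> = \<gamma> (hyperplane_proj \<nu> x)"
proof -
  let ?S = "{y. y \<bullet> \<nu> = 0} \<inter> ball (hyperplane_proj \<nu> p) r"
  have inS: "hyperplane_proj \<nu> y \<in> ?S" if "y \<in> ball p r" for y
    using that hyperplane_proj_in[OF \<nu>] dist_hyperplane_proj_le[OF \<nu>, of p y] by auto
  have "x \<notin> \<Omega>" using x(1) \<Omega> by (simp add: frontier_def interior_open)
  then have "x \<notin> {x \<in> ball p r. x \<bullet> \<nu> > \<gamma> (hyperplane_proj \<nu> x)}" using eq by blast
  then have le: "x \<bullet> \<nu> \<le> \<gamma> (hyperplane_proj \<nu> x)" using x(2) by (simp add: not_less)
  have "x \<in> closure \<Omega>" using x(1) by (simp add: frontier_def)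
  then obtain X where X: "\<And>n. X n \<in> \<Omega>" "X \<longlonglongrightarrow> x" by (auto simp: closure_sequential)
  have hp: "(\<lambda>n. dist (hyperplane_proj \<nu> (X n)) (hyperplane_proj \<nu> x)) \<longlonglongrightarrow> 0"
  proof (rule Lim_null_comparison)
    show "\<forall>\<^sub>F n in sequentially. norm (dist (hyperplane_proj \<nu> (X n)) (hyperplane_proj \<nu> x)) \<le> dist (X n) x"
      using dist_hyperplane_proj_le[OF \<nu>] by simp
    show "(\<lambda>n. dist (X n) x) \<longlonglongrightarrow> 0" using X(2) tendsto_dist_iff by blast
  qed
  have "\<forall>\<^sub>F n in sequentially. X n \<in> ball p r"
    using X(2) x(2) by (rule topological_tendstoD[OF _ open_ball])
  then have "\<forall>\<^sub>F n in sequentially. \<gamma> (hyperplane_proj \<nu> x) - L * dist (hyperplane_proj \<nu> (X n)) (hyperplane_proj \<nu> x) \<le> X n \<bullet> \<nu>"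
  proof eventually_elim
    case (elim n)
    then have "X n \<bullet> \<nu> > \<gamma> (hyperplane_proj \<nu> (X n))" using equalityD1[OF eq] X(1)[of n] by blast
    moreover have "\<bar>\<gamma> (hyperplane_proj \<nu> (X n)) - \<gamma> (hyperplane_proj \<nu> x)\<bar>
        \<le> L * dist (hyperplane_proj \<nu> (X n)) (hyperplane_proj \<nu> x)"
      using Lip[OF inS[OF elim] inS[OF x(2)]] .
    ultimately show ?case by linarith
  qed
  moreover have "(\<lambda>n. X n \<bullet> \<nu>) \<longlonglongrightarrow> x \<bullet> \<nu>" by (intro tendsto_intros X)
  moreover have "(\<lambda>n. \<gamma> (hyperplane_proj \<nu> x) - L * dist (hyperplane_proj \<nu> (X n)) (hyperplane_proj \<nu> x))
     \<longlonglongrightarrow> \<gamma> (hyperplane_proj \<nu> x) - L * 0"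
    by (intro tendsto_intros hp)
  ultimately have "\<gamma> (hyperplane_proj \<nu> x) - L * 0 \<le> x \<bullet> \<nu>"
    using tendsto_le[OF trivial_limit_sequentially] by blast
  then show ?thesis using le by simp
qed

text \<open>
  On the graph of an \<open>L\<close>-Lipschitz function the projection to the base has a \<open>(1 + L)\<close>-Lipschitz
  inverse. The centre \<open>z\<close> ranges over the whole space because the potential is studied at points off the
  surface, too.
\<close>

lemma frontier_local_growth:
  fixes \<Omega> :: "'a::euclidean_space set"
  assumes \<Omega>: "open \<Omega>" and lam: "0 \<le> lam" and bd: "C1_holder_boundary lam \<Omega>" and p: "p \<in> frontier \<Omega>"
  shows "\<exists>r>0. \<exists>c\<ge>0. \<forall>z \<rho>. 0 < \<rho> \<longrightarrow>
    hausdorff_outer (DIM('a) - 1) (frontier \<Omega> \<inter> ball p r \<inter> cball z \<rho>) \<le> ennreal (c * \<rho> ^ (DIM('a) - 1))"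
proof -
  obtain \<nu> r \<gamma> where \<nu>: "norm \<nu> = 1" and r: "r > 0"
    and C1: "C1_holder_on lam ({y. y \<bullet> \<nu> = 0} \<inter> ball (hyperplane_proj \<nu> p) r) \<gamma>"
    and eq: "\<Omega> \<inter> ball p r = {x \<in> ball p r. x \<bullet> \<nu> > \<gamma> (hyperplane_proj \<nu> x)}"
    using bd p unfolding C1_holder_boundary_def by meson
  let ?S = "{y. y \<bullet> \<nu> = 0} \<inter> ball (hyperplane_proj \<nu> p) r"
  have "convex {y. y \<bullet> \<nu> = 0}" using convex_hyperplane[of \<nu> 0] by (simp add: inner_commute)
  then have "convex ?S" by (intro convex_Int) auto
  moreover have "bounded ?S" by (rule bounded_subset[OF bounded_ball]) auto
  ultimately obtain L where L: "0 \<le> L" "\<And>y z. y \<in> ?S \<Longrightarrow> z \<in> ?S \<Longrightarrow> \<bar>\<gamma> y - \<gamma> z\<bar> \<le> L * dist y z"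
    using C1_holder_on_lipschitz[OF C1 _ _ lam] by meson
  let ?E = "frontier \<Omega> \<inter> ball p r"
  have Lip: "dist x y \<le> (1 + L) * dist (hyperplane_proj \<nu> x) (hyperplane_proj \<nu> y)"
    if x: "x \<in> ?E" and y: "y \<in> ?E" for x y
  proof -
    have inS: "hyperplane_proj \<nu> w \<in> ?S" if "w \<in> ball p r" for w
      using that hyperplane_proj_in[OF \<nu>] dist_hyperplane_proj_le[OF \<nu>, of p w] by auto
    have g: "w \<bullet> \<nu> = \<gamma> (hyperplane_proj \<nu> w)" if "w \<in> ?E" for w
      using that by (intro frontier_local_graph[OF \<Omega> \<nu> eq L(2)]) auto
    have "x - y = hyperplane_proj \<nu> (x - y) + (x \<bullet> \<nu> - y \<bullet> \<nu>) *\<^sub>R \<nu>"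
      by (simp add: hyperplane_proj_def inner_diff_left)
    then have "norm (x - y) \<le> norm (hyperplane_proj \<nu> (x - y)) + norm ((x \<bullet> \<nu> - y \<bullet> \<nu>) *\<^sub>R \<nu>)"
      by (metis norm_triangle_ineq)
    moreover have "norm ((x \<bullet> \<nu> - y \<bullet> \<nu>) *\<^sub>R \<nu>) = \<bar>\<gamma> (hyperplane_proj \<nu> x) - \<gamma> (hyperplane_proj \<nu> y)\<bar>"
      using \<nu> g[OF x] g[OF y] by simp
    moreover have "\<dots> \<le> L * dist (hyperplane_proj \<nu> x) (hyperplane_proj \<nu> y)"
      using x y by (intro L inS) auto
    ultimately show ?thesis
      by (simp add: dist_norm hyperplane_proj_diff algebra_simps)
  qed
  show ?thesis
    using hausdorff_outer_graph_le[OF \<nu> _ _ Lip, of _ "?E"] L(1) r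
    by (intro exI[of _ r] conjI exI[of _ "unit_ball_vol (real (DIM('a) - 1)) * (3 * (1 + L) * real (DIM('a) - 1) / 2) ^ (DIM('a) - 1)"])
       auto
qed

lemma hausdorff_outer_finite_UN:
  assumes "finite I"
  shows "hausdorff_outer k (\<Union>i\<in>I. A i) \<le> (\<Sum>i\<in>I. hausdorff_outer k (A i))"
  using assms
proof (induction I)
  case (insert i I)
  have "hausdorff_outer k (\<Union>j\<in>insert i I. A j) \<le> hausdorff_outer k (A i) + hausdorff_outer k (\<Union>j\<in>I. A j)"
    using hausdorff_outer_Un[of k "A i" "\<Union>j\<in>I. A j"] by simp
  also have "\<dots> \<le> hausdorff_outer k (A i) + (\<Sum>j\<in>I. hausdorff_outer k (A j))"
    by (intro add_left_mono insert.IH)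
  finally show ?case using insert by simp
qed (simp add: hausdorff_outer_empty)

lemma frontier_growth:
  fixes \<Omega> :: "'a::euclidean_space set"
  assumes \<Omega>: "open \<Omega>" "bounded \<Omega>" and lam: "0 \<le> lam" and bd: "C1_holder_boundary lam \<Omega>"
  shows "\<exists>c\<ge>0. \<forall>z \<rho>. 0 < \<rho> \<longrightarrow>
    hausdorff_outer (DIM('a) - 1) (frontier \<Omega> \<inter> cball z \<rho>) \<le> ennreal (c * \<rho> ^ (DIM('a) - 1))"
proof -
  let ?k = "DIM('a) - 1" and ?F = "frontier \<Omega>"
  obtain r c where rc: "\<And>p. p \<in> ?F \<Longrightarrow> r p > (0::real) \<and> c p \<ge> 0 \<and> (\<forall>z \<rho>. 0 < \<rho> \<longrightarrow>
    hausdorff_outer ?k (?F \<inter> ball p (r p) \<inter> cball z \<rho>) \<le> ennreal (c p * \<rho> ^ ?k))"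
    using frontier_local_growth[OF \<Omega>(1) lam bd] by metis
  have "compact ?F" using \<Omega>(2) by (simp add: compact_frontier_bounded)
  then obtain P where P: "P \<subseteq> ?F" "finite P" "?F \<subseteq> (\<Union>p\<in>P. ball p (r p))"
    using rc by (elim compactE_image[where C = ?F and f = "\<lambda>p. ball p (r p)"]) force+
  show ?thesis
  proof (intro exI[of _ "sum c P"] conjI allI impI)
    show "0 \<le> sum c P" using P rc by (intro sum_nonneg) auto
    fix z :: 'a and \<rho> :: real assume \<rho>: "0 < \<rho>"
    have "hausdorff_outer ?k (?F \<inter> cball z \<rho>) \<le> hausdorff_outer ?k (\<Union>p\<in>P. ?F \<inter> ball p (r p) \<inter> cball z \<rho>)"
      using P(3) by (intro hausdorff_outer_mono) auto
    also have "\<dots> \<le> (\<Sum>p\<in>P. hausdorff_outer ?k (?F \<inter> ball p (r p) \<inter> cball z \<rho>))"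
      by (rule hausdorff_outer_finite_UN[OF P(2)])
    also have "\<dots> \<le> (\<Sum>p\<in>P. ennreal (c p * \<rho> ^ ?k))"
      using P(1) rc \<rho> by (intro sum_mono) auto
    also have "\<dots> = ennreal (\<Sum>p\<in>P. c p * \<rho> ^ ?k)"
      using P(1) rc \<rho> by (intro sum_ennreal) auto
    finally show "hausdorff_outer ?k (?F \<inter> cball z \<rho>) \<le> ennreal (sum c P * \<rho> ^ ?k)"
      by (simp add: sum_distrib_right)
  qed
qed

lemma sets_hausdorff_measure [simp]: "sets (hausdorff_measure k :: 'a::metric_space measure) = sets borel"
  by (simp add: hausdorff_measure_def sigma_algebra.sigma_sets_eq[OF sets.sigma_algebra_axioms[of borel, simplified]])

lemma space_hausdorff_measure [simp]: "space (hausdorff_measure k) = UNIV"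
  by (simp add: hausdorff_measure_def)

lemma space_surface_measure: "space (surface_measure \<Omega>) = frontier \<Omega>"
  by (simp add: surface_measure_def space_restrict_space hausdorff_measure_def)

lemma ident_measurable_surface_measure: "(\<lambda>\<xi>. \<xi>) \<in> borel_measurable (surface_measure \<Omega>)"
proof -
  have "(\<lambda>\<xi>. \<xi>) \<in> borel_measurable (hausdorff_measure k :: 'a measure)" for k
    by (simp cong: measurable_cong_sets)
  then show ?thesis
    unfolding surface_measure_def by (intro measurable_completion measurable_restrict_space1)
qed

lemma emeasure_surface_measure:
  fixes \<Omega> :: "'a::euclidean_space set"
  assumes "A \<in> sets borel"
  shows "emeasure (surface_measure \<Omega>) (frontier \<Omega> \<inter> A) = hausdorff_outer (DIM('a) - 1) (frontier \<Omega> \<inter> A)"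
proof -
  have F: "frontier \<Omega> \<in> sets borel" by (intro borel_closed frontier_closed)
  then have "frontier \<Omega> \<inter> A \<in> sets (restrict_space (hausdorff_measure (DIM('a) - 1)) (frontier \<Omega>))"
    using assms by (simp add: sets_restrict_space_iff)
  then show ?thesis
    using F assms unfolding surface_measure_def
    by (simp add: emeasure_restrict_space emeasure_hausdorff_measure)
qed

lemma surface_measure_growth:
  fixes \<Omega> :: "'a::euclidean_space set"
  assumes "open \<Omega>" "bounded \<Omega>" "0 \<le> lam" "C1_holder_boundary lam \<Omega>"
  shows "\<exists>c\<ge>0. \<forall>z \<rho>. 0 < \<rho> \<longrightarrow>
    emeasure (surface_measure \<Omega>) (frontier \<Omega> \<inter> cball z \<rho>) \<le> ennreal (c * \<rho> ^ (DIM('a) - 1))"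
  using frontier_growth[OF assms] by (simp add: emeasure_surface_measure)

lemma finite_surface_measure:
  assumes "bounded \<Omega>" and "\<And>z \<rho>. 0 < \<rho> \<Longrightarrow>
    emeasure (surface_measure \<Omega>) (frontier \<Omega> \<inter> cball z \<rho>) \<le> ennreal (c * \<rho> ^ (DIM('a) - 1))"
  shows "finite_measure (surface_measure (\<Omega> :: 'a::euclidean_space set))"
proof -
  have "bounded (frontier \<Omega>)" by (rule compact_imp_bounded[OF compact_frontier_bounded[OF assms(1)]])
  then obtain R where R: "0 < R" "frontier \<Omega> \<subseteq> cball 0 R"
    using bounded_subset_ballD[of "frontier \<Omega>" 0] ball_subset_cball by blast
  then have "frontier \<Omega> \<inter> cball 0 R = frontier \<Omega>" by blast
  then have "emeasure (surface_measure \<Omega>) (frontier \<Omega>) \<le> ennreal (c * R ^ (DIM('a) - 1))"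
    using assms(2)[OF R(1), of 0] by simp
  then show ?thesis
    by (intro finite_measureI) (auto simp: space_surface_measure top_unique)
qed

section \<open>Integrals of the heat kernel over the surface and in time\<close>

text \<open>
  Gaussian decay beats every power, with an explicit constant: \<open>(1 + r)\<^sup>N / N!\<close> is a term of the
  series of \<open>exp (1 + r)\<close>, and \<open>1 + r - r\<^sup>2/4 \<le> 2\<close> by completing the square.
\<close>

lemma power_mult_exp_neg_square_le:
  fixes r :: real assumes "0 \<le> r"
  shows "(1 + r) ^ N * exp (- r\<^sup>2 / 4) \<le> fact N * exp 2"
proof -
  have "(1 + r) ^ N / fact N \<le> exp (1 + r)"
  proof -
    have "(\<lambda>n. (1 + r) ^ n / fact n) sums exp (1 + r)"
      using exp_converges[of "1 + r"] by (simp add: divide_inverse mult.commute)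
    then have s: "summable (\<lambda>n. (1 + r) ^ n / fact n)" "(\<Sum>n. (1 + r) ^ n / fact n) = exp (1 + r)"
      by (simp_all add: sums_iff)
    have "(\<Sum>n\<in>{N}. (1 + r) ^ n / fact n) \<le> (\<Sum>n. (1 + r) ^ n / fact n)"
      using assms by (intro sum_le_suminf s(1)) auto
    then show ?thesis using s(2) by simp
  qed
  then have "(1 + r) ^ N \<le> fact N * exp (1 + r)" by (simp add: field_simps)
  then have "(1 + r) ^ N * exp (- r\<^sup>2 / 4) \<le> fact N * exp (1 + r) * exp (- r\<^sup>2 / 4)"
    by (rule mult_right_mono) simp
  also have "\<dots> = fact N * exp (1 + r - r\<^sup>2 / 4)" by (simp add: exp_add[symmetric] mult.assoc)
  also have "\<dots> \<le> fact N * exp 2"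
  proof -
    have "0 \<le> (r / 2 - 1)\<^sup>2" by simp
    then have "1 + r - r\<^sup>2 / 4 \<le> 2" by (simp add: power2_eq_square algebra_simps)
    then show ?thesis by simp
  qed
  finally show ?thesis .
qed

lemma term_le_suminf_ennreal: "f j \<le> (\<Sum>j. f j)" for f :: "nat \<Rightarrow> ennreal"
  using sum_le_suminf[of f "{j}"] by simp

lemma heat_kernel_nonneg: "0 \<le> heat_kernel z s"
  by (simp add: heat_kernel_def)

lemma heat_kernel_le_diag: "heat_kernel z s \<le> (4 * pi * s) powr (- (real DIM('a) / 2))"
  for z :: "'a::euclidean_space"
  by (auto simp: heat_kernel_def mult_le_cancel_left1 mult_nonneg_nonneg)

lemma heat_kernel_measurable [measurable]:
  "case_prod (heat_kernel :: 'a::euclidean_space \<Rightarrow> real \<Rightarrow> real) \<in> borel_measurable (borel \<Otimes>\<^sub>M borel)"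
  unfolding heat_kernel_def split_def by measurable

text \<open>
  Nested balls replace disjoint shells: the term whose index is the integer part of \<open>|x - \<xi>| / \<surd>s\<close>
  alone dominates the kernel. The set \<open>X\<close> is the space of the measure to be integrated against.
\<close>

lemma heat_kernel_le_shell_sum:
  fixes x \<xi> :: "'a::euclidean_space"
  assumes s: "0 < s" and \<xi>: "\<xi> \<in> X"
  shows "ennreal (heat_kernel (x - \<xi>) s)
    \<le> (\<Sum>j. ennreal ((4 * pi * s) powr (- (real DIM('a) / 2)) * (fact N * exp 2 / (1 + real j) ^ N))
         * indicator (X \<inter> cball x ((1 + real j) * sqrt s)) \<xi>)"
    (is "_ \<le> (\<Sum>j. ?f j)")
proof -
  define r where "r = norm (x - \<xi>) / sqrt s"
  have r: "0 \<le> r" using s by (simp add: r_def)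
  define j where "j = nat \<lfloor>r\<rfloor>"
  have j: "real j \<le> r" "r < 1 + real j" using r unfolding j_def by linarith+
  have r2: "r\<^sup>2 = (norm (x - \<xi>))\<^sup>2 / s" using s by (simp add: r_def power_divide)
  have "(1 + real j) ^ N * exp (- r\<^sup>2 / 4) \<le> (1 + r) ^ N * exp (- r\<^sup>2 / 4)"
    using j by (intro mult_right_mono power_mono) auto
  also have "\<dots> \<le> fact N * exp 2" by (rule power_mult_exp_neg_square_le[OF r])
  finally have "exp (- r\<^sup>2 / 4) \<le> fact N * exp 2 / (1 + real j) ^ N"
    by (simp add: pos_le_divide_eq mult.commute)
  moreover have "heat_kernel (x - \<xi>) s = (4 * pi * s) powr (- (real DIM('a) / 2)) * exp (- r\<^sup>2 / 4)"
    using s by (simp add: heat_kernel_def r2 mult.commute)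
  ultimately have "heat_kernel (x - \<xi>) s
      \<le> (4 * pi * s) powr (- (real DIM('a) / 2)) * (fact N * exp 2 / (1 + real j) ^ N)"
    using mult_left_mono by (metis powr_ge_zero)
  moreover have "norm (x - \<xi>) \<le> (1 + real j) * sqrt s"
    using j(2) s unfolding r_def by (simp add: divide_less_eq)
  ultimately have "ennreal (heat_kernel (x - \<xi>) s) \<le> ?f j"
    using \<xi> by (simp add: dist_norm ennreal_leI)
  also have "?f j \<le> (\<Sum>j. ?f j)"
    by (rule term_le_suminf_ennreal)
  finally show ?thesis .
qed

text \<open>
  The spatial half of the estimate. With exponent \<open>N = k + 2\<close>, where \<open>k = n - 1\<close>, the term of index
  \<open>j\<close> contributes \<open>(1 + j)\<^bsup>k\<^esup> / (1 + j)\<^bsup>k+2\<^esup>\<close>, which is summable, and the powers of \<open>s\<close> combine to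
  \<open>s\<^bsup>-n/2\<^esup> s\<^bsup>(n-1)/2\<^esup> = s\<^bsup>-1/2\<^esup>\<close>.
\<close>

lemma heat_kernel_surface_integral_le:
  fixes \<sigma> :: "'a::euclidean_space measure"
  assumes [measurable]: "(\<lambda>\<xi>. \<xi>) \<in> borel_measurable \<sigma>"
    and growth: "\<And>z \<rho>. 0 < \<rho> \<Longrightarrow> emeasure \<sigma> (space \<sigma> \<inter> cball z \<rho>) \<le> ennreal (c * \<rho> ^ (DIM('a) - 1))"
    and c: "0 \<le> c"
  shows "\<exists>C\<ge>0. \<forall>x s. 0 < s \<longrightarrow> (\<integral>\<^sup>+\<xi>. ennreal (heat_kernel (x - \<xi>) s) \<partial>\<sigma>) \<le> ennreal (C / sqrt s)"
proof -
  define k where "k = DIM('a) - 1"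
  have n: "real DIM('a) = real k + 1" using DIM_positive[where 'a='a] unfolding k_def by linarith
  define B :: real where "B = fact (k + 2) * exp 2"
  have B: "0 \<le> B" by (simp add: B_def)
  define S :: real where "S = (\<Sum>j. 1 / (1 + real j)\<^sup>2)"
  have summ: "summable (\<lambda>j. 1 / (1 + real j)\<^sup>2)"
    using inverse_squares_sums by (simp add: sums_iff add.commute)
  have S: "0 \<le> S" unfolding S_def by (intro suminf_nonneg summ) auto
  define C where "C = (4 * pi) powr (- (real DIM('a) / 2)) * B * c * S"
  show ?thesis
  proof (intro exI[of _ C] conjI allI impI)
    show "0 \<le> C" using B c S by (simp add: C_def)
    fix x :: 'a and s :: real assume s: "0 < s"
    define P where "P = (4 * pi * s) powr (- (real DIM('a) / 2))"
    have P: "0 \<le> P" by (simp add: P_def)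
    define b where "b j = P * (B / (1 + real j) ^ (k + 2))" for j :: nat
    have b: "0 \<le> b j" for j using P B by (simp add: b_def)
    let ?A = "\<lambda>j::nat. space \<sigma> \<inter> cball x ((1 + real j) * sqrt s)"
    have A[measurable]: "?A j \<in> sets \<sigma>" for j
      using measurable_sets[OF assms(1), of "cball x ((1 + real j) * sqrt s)"]
      by (simp add: Int_commute vimage_def Collect_conj_eq[symmetric] Int_def conj_commute)
    have "(\<integral>\<^sup>+\<xi>. ennreal (heat_kernel (x - \<xi>) s) \<partial>\<sigma>)
        \<le> (\<integral>\<^sup>+\<xi>. (\<Sum>j. ennreal (b j) * indicator (?A j) \<xi>) \<partial>\<sigma>)"
      using heat_kernel_le_shell_sum[OF s, of _ "space \<sigma>" x "k + 2"]
      by (intro nn_integral_mono) (simp add: b_def P_def B_def)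
    also have "\<dots> = (\<Sum>j. \<integral>\<^sup>+\<xi>. ennreal (b j) * indicator (?A j) \<xi> \<partial>\<sigma>)"
      by (rule nn_integral_suminf) measurable
    also have "\<dots> = (\<Sum>j. ennreal (b j) * emeasure \<sigma> (?A j))"
      by (simp add: nn_integral_cmult_indicator)
    also have "\<dots> \<le> (\<Sum>j. ennreal (C / sqrt s / S * (1 / (1 + real j)\<^sup>2)))"
    proof (intro suminf_le)
      fix j
      let ?t = "(1 + real j)"
      have "emeasure \<sigma> (?A j) \<le> ennreal (c * (?t * sqrt s) ^ k)"
        using s unfolding k_def by (intro growth) auto
      then have "ennreal (b j) * emeasure \<sigma> (?A j) \<le> ennreal (b j) * ennreal (c * (?t * sqrt s) ^ k)"
        by (intro mult_left_mono) auto
      also have "\<dots> = ennreal (b j * (c * (?t * sqrt s) ^ k))"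
        using b c s by (intro ennreal_mult[symmetric]) auto
      also have "b j * (c * (?t * sqrt s) ^ k) = P * sqrt s ^ k * B * c * (1 / ?t\<^sup>2)"
      proof -
        have "P * (B / t ^ (k + 2)) * (c * (t * sqrt s) ^ k) = P * sqrt s ^ k * B * c * (1 / t\<^sup>2)"
          if "0 < t" for t
          using that by (simp add: power_mult_distrib power_add power2_eq_square)
        then show ?thesis unfolding b_def by simp
      qed
      also have "P * sqrt s ^ k = (4 * pi) powr (- (real DIM('a) / 2)) / sqrt s"
      proof -
        have "sqrt s ^ k = s powr (real k / 2)"
          using s by (simp add: powr_half_sqrt[symmetric] powr_realpow[symmetric] powr_powr)
        moreover have "s powr (- (real DIM('a) / 2)) * s powr (real k / 2) = s powr (- (1/2))"
          by (simp add: powr_add[symmetric] n add_divide_distrib)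
        ultimately show ?thesis
          using s powr_minus[of s "1/2"] powr_half_sqrt[of s]
          by (simp only: P_def powr_mult divide_inverse mult.assoc)
      qed
      also have "(4 * pi) powr (- (real DIM('a) / 2)) / sqrt s * B * c * (1 / ?t\<^sup>2)
          = C / sqrt s / S * (1 / ?t\<^sup>2)"
      proof -
        \<comment> \<open>\<open>S\<close> is nonzero, so that the division that normalises the series is harmless\<close>
        have "1 \<le> S" unfolding S_def using sum_le_suminf[OF summ, of "{0}"] by simp
        then show ?thesis by (simp add: C_def field_simps)
      qed
      finally show "ennreal (b j) * emeasure \<sigma> (?A j) \<le> ennreal (C / sqrt s / S * (1 / ?t\<^sup>2))" .
    qed auto
    also have "\<dots> = ennreal (C / sqrt s / S * S)"
      using s \<open>0 \<le> C\<close> S summ unfolding S_def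
      by (intro suminf_ennreal_eq sums_mult summable_sums) auto
    also have "\<dots> \<le> ennreal (C / sqrt s)"
      using s \<open>0 \<le> C\<close> S by (intro ennreal_leI) (cases "S = 0", auto)
    finally show "(\<integral>\<^sup>+\<xi>. ennreal (heat_kernel (x - \<xi>) s) \<partial>\<sigma>) \<le> ennreal (C / sqrt s)" .
  qed
qed

lemma LINT_upper_limit_continuous:
  fixes f :: "real \<Rightarrow> real"
  assumes f: "set_integrable lebesgue {a..b} f"
  shows "continuous_on {a..b} (\<lambda>t. LINT z:{a..t}|lebesgue. f z)"
proof -
  have "f integrable_on {a..b}" using f by (rule set_lebesgue_integral_eq_integral)
  then have "continuous_on {a..b} (\<lambda>t. integral {a..t} f)" by (rule indefinite_integral_continuous_1)
  then show ?thesis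
  proof (rule continuous_on_eq)
    fix t assume "t \<in> {a..b}"
    then show "integral {a..t} f = (LINT z:{a..t}|lebesgue. f z)"
      by (intro set_lebesgue_integral_eq_integral(2)[symmetric] set_integrable_subset[OF f]) auto
  qed
qed

text \<open>
  The index \<open>j\<close> is the one with \<open>c / 4\<^bsup>j+1\<^esup> < y \<le> c / 4\<^bsup>j\<^esup>\<close>; powers of four make the
  square roots powers of two.
\<close>

lemma inverse_sqrt_dyadic_bound:
  assumes "0 < y" "y \<le> c"
  shows "\<exists>j. y \<le> c / 4 ^ j \<and> 1 / sqrt y \<le> 2 ^ Suc j / sqrt c"
proof -
  have c: "0 < c" using assms by simp
  have "\<exists>i. c / 4 ^ i < y"
  proof -
    obtain i where "(1/4) ^ i < y / c"
      using real_arch_pow_inv[of "y / c" "1/4"] assms c by auto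
    then show ?thesis using c by (intro exI[of _ i]) (simp add: field_simps power_divide)
  qed
  \<comment> \<open>the predecessor of the first level below \<open>y\<close> is the level that contains \<open>y\<close>\<close>
  define i where "i = (LEAST i. c / 4 ^ i < y)"
  have i: "c / 4 ^ i < y" unfolding i_def by (rule LeastI_ex) fact
  have "i \<noteq> 0"
  proof
    assume "i = 0"
    then show False using i assms by simp
  qed
  then obtain j where j: "i = Suc j" using not0_implies_Suc by blast
  have "\<not> c / 4 ^ j < y" using not_less_Least[of j "\<lambda>i. c / 4 ^ i < y"] j by (simp add: i_def)
  moreover have "sqrt c / 2 ^ Suc j \<le> sqrt y"
  proof -
    have "sqrt (c / 4 ^ i) \<le> sqrt y" using i by simp
    moreover have "sqrt ((4::real) ^ i) = 2 ^ i" by (simp add: real_sqrt_power)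
    ultimately show ?thesis by (simp add: j real_sqrt_divide)
  qed
  then have "1 / sqrt y \<le> 1 / (sqrt c / 2 ^ Suc j)"
    using c assms by (intro divide_left_mono) auto
  then have "1 / sqrt y \<le> 2 ^ Suc j / sqrt c" by simp
  ultimately show ?thesis by (intro exI[of _ j]) auto
qed

locale time_coefficient =
  fixes T :: real and a :: "real \<Rightarrow> real"
  assumes a_L1: "set_integrable lebesgue {0..T} a"
    and a_nonneg: "\<And>t. t \<in> {0..T} \<Longrightarrow> 0 \<le> a t"
begin

lemma a_L1_sub: "0 \<le> \<tau> \<Longrightarrow> t \<le> T \<Longrightarrow> set_integrable lebesgue {\<tau>..t} a"
  by (rule set_integrable_subset[OF a_L1]) auto

lemma coeff_prim_eq_integral: "t \<le> T \<Longrightarrow> coeff_prim a t = integral {0..t} a"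
  unfolding coeff_prim_def by (intro set_lebesgue_integral_eq_integral a_L1_sub) auto

lemma coeff_prim_continuous: "continuous_on {0..T} (coeff_prim a)"
  using LINT_upper_limit_continuous[OF a_L1] by (simp add: coeff_prim_def[abs_def])

lemma coeff_int_eq_LINT:
  assumes "0 \<le> \<tau>" "\<tau> \<le> t" "t \<le> T"
  shows "coeff_int a t \<tau> = (LINT z:{\<tau>..t}|lebesgue. a z)"
proof -
  have "a integrable_on {0..t}"
    by (rule set_lebesgue_integral_eq_integral) (use a_L1_sub[of 0 t] assms in auto)
  then have "integral {0..\<tau>} a + integral {\<tau>..t} a = integral {0..t} a"
    using assms by (intro Henstock_Kurzweil_Integration.integral_combine) auto
  moreover have "(LINT z:{\<tau>..t}|lebesgue. a z) = integral {\<tau>..t} a"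
    using assms by (intro set_lebesgue_integral_eq_integral a_L1_sub) auto
  ultimately show ?thesis using assms by (simp add: coeff_int_def coeff_prim_eq_integral)
qed

lemma coeff_int_nonneg:
  assumes "0 \<le> \<tau>" "\<tau> \<le> t" "t \<le> T"
  shows "0 \<le> coeff_int a t \<tau>"
  unfolding coeff_int_eq_LINT[OF assms] set_lebesgue_integral_def
  using assms a_nonneg by (intro integral_nonneg_AE) (auto simp: indicator_def)

lemma coeff_int_pos_imp_less:
  assumes "0 \<le> t" "\<tau> \<le> T" "0 < coeff_int a t \<tau>"
  shows "\<tau> < t"
proof (rule ccontr)
  assume "\<not> \<tau> < t"
  then have "0 \<le> coeff_int a \<tau> t" using assms by (intro coeff_int_nonneg) auto
  then show False using assms(3) by (simp add: coeff_int_def)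
qed

lemma coeff_int_continuous: "continuous_on {0..T} (coeff_int a t)"
  unfolding coeff_int_def by (intro continuous_intros coeff_prim_continuous)

lemma coeff_int_measurable [measurable]: "coeff_int a t \<in> borel_measurable (lebesgue_on {0..T})"
  by (intro continuous_imp_measurable_on_sets_lebesgue coeff_int_continuous) auto

lemma a_integrable: "integrable (lebesgue_on {0..T}) a"
  using a_L1 by (simp add: set_integrable_def integrable_restrict_space)

lemma a_measurable [measurable]: "a \<in> borel_measurable (lebesgue_on {0..T})"
  using a_integrable by (rule borel_measurable_integrable)

text \<open>
  The set of times with \<open>0 < b(t,\<tau>) \<le> c\<close> lies in \<open>[u,t]\<close>, where \<open>u\<close> is the first time with
  \<open>b(t,u) \<le> c\<close>, and the integral of \<open>a\<close> over \<open>[u,t]\<close> is \<open>b(t,u)\<close> itself. In other words, the image of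
  \<open>a(\<tau>) d\<tau>\<close> under \<open>b(t,\<cdot>)\<close> gives each interval \<open>(0,c]\<close> at most its length; for a merely integrable \<open>a\<close>
  this takes the place of a change of variables.
\<close>

lemma coeff_level_set_le:
  assumes t: "t \<in> {0..T}" and c: "0 \<le> c"
  shows "(\<integral>\<^sup>+\<tau>. ennreal (a \<tau>) * indicator {\<tau>. 0 < coeff_int a t \<tau> \<and> coeff_int a t \<tau> \<le> c} \<tau>
           \<partial>lebesgue_on {0..T}) \<le> ennreal c"
proof -
  let ?K = "{\<tau>\<in>{0..t}. coeff_int a t \<tau> \<le> c}"
  have cont: "continuous_on {0..t} (coeff_int a t)"
    by (rule continuous_on_subset[OF coeff_int_continuous]) (use t in auto)
  have "closed ({0..t} \<inter> coeff_int a t -` {..c})"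
    by (rule continuous_closed_preimage[OF cont]) auto
  moreover have "?K = {0..t} \<inter> ({0..t} \<inter> coeff_int a t -` {..c})" by auto
  ultimately have "compact ?K" by (metis compact_Icc compact_Int_closed)
  moreover have "t \<in> ?K" using t c by (simp add: coeff_int_def)
  ultimately obtain u where u: "u \<in> ?K" "\<And>\<tau>. \<tau> \<in> ?K \<Longrightarrow> u \<le> \<tau>"
    using compact_attains_inf[of ?K] by blast
  have "(\<integral>\<^sup>+\<tau>. ennreal (a \<tau>) * indicator {\<tau>. 0 < coeff_int a t \<tau> \<and> coeff_int a t \<tau> \<le> c} \<tau>
           \<partial>lebesgue_on {0..T}) \<le> (\<integral>\<^sup>+\<tau>. ennreal (indicator {u..t} \<tau> * a \<tau>) \<partial>lebesgue_on {0..T})"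
  proof (rule nn_integral_mono)
    fix \<tau> assume "\<tau> \<in> space (lebesgue_on {0..T})"
    then have \<tau>: "\<tau> \<in> {0..T}" by simp
    have "u \<le> \<tau> \<and> \<tau> \<le> t" if "0 < coeff_int a t \<tau>" "coeff_int a t \<tau> \<le> c"
      using coeff_int_pos_imp_less[OF _ _ that(1)] u(2)[of \<tau>] that \<tau> t by auto
    then show "ennreal (a \<tau>) * indicator {\<tau>. 0 < coeff_int a t \<tau> \<and> coeff_int a t \<tau> \<le> c} \<tau>
        \<le> ennreal (indicator {u..t} \<tau> * a \<tau>)"
      by (auto simp: indicator_def)
  qed
  also have "\<dots> = (\<integral>\<^sup>+\<tau>. ennreal (indicator {u..t} \<tau> * a \<tau>) \<partial>lebesgue)"
    using u t by (subst nn_integral_restrict_space) (auto intro!: nn_integral_cong simp: indicator_def)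
  also have "\<dots> = ennreal (LINT \<tau>:{u..t}|lebesgue. a \<tau>)"
    using a_L1_sub[of u t] u t a_nonneg
    unfolding set_lebesgue_integral_def set_integrable_def
    by (subst nn_integral_eq_integral) (auto simp: indicator_def)
  also have "\<dots> = ennreal (coeff_int a t u)"
    using u t by (subst coeff_int_eq_LINT) auto
  also have "\<dots> \<le> ennreal c" using u by (intro ennreal_leI) auto
  finally show ?thesis .
qed

text \<open>
  The temporal half of the estimate. On the dyadic level \<open>j\<close> the factor \<open>b\<^bsup>-1/2\<^esup>\<close> is at
  most \<open>2\<^bsup>j+1\<^esup> / \<surd>c\<close> and the measure \<open>a(\<tau>) d\<tau>\<close> of the level at most \<open>c / 4\<^bsup>j\<^esup>\<close>, so that the contributions form a geometric
  series.
\<close>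

lemma inverse_sqrt_coeff_integral_le:
  assumes t: "t \<in> {0..T}" and c: "0 < c"
  shows "(\<integral>\<^sup>+\<tau>. ennreal (a \<tau> / sqrt (coeff_int a t \<tau>))
            * indicator {\<tau>. 0 < coeff_int a t \<tau> \<and> coeff_int a t \<tau> \<le> c} \<tau>
           \<partial>lebesgue_on {0..T}) \<le> ennreal (4 * sqrt c)"
proof -
  let ?L = "lebesgue_on {0..T}" and ?b = "coeff_int a t"
  let ?D = "\<lambda>c. {\<tau>. 0 < ?b \<tau> \<and> ?b \<tau> \<le> c}"
  let ?w = "\<lambda>j::nat. 2 ^ Suc j / sqrt c"
  let ?f = "\<lambda>j \<tau>. ennreal (?w j) * (ennreal (a \<tau>) * indicator (?D (c / 4 ^ j)) \<tau>)"
  have "(\<integral>\<^sup>+\<tau>. ennreal (a \<tau> / sqrt (?b \<tau>)) * indicator (?D c) \<tau> \<partial>?L) \<le> (\<integral>\<^sup>+\<tau>. (\<Sum>j. ?f j \<tau>) \<partial>?L)"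
  proof (rule nn_integral_mono)
    fix \<tau> assume "\<tau> \<in> space ?L"
    then have a: "0 \<le> a \<tau>" using a_nonneg by simp
    show "ennreal (a \<tau> / sqrt (?b \<tau>)) * indicator (?D c) \<tau> \<le> (\<Sum>j. ?f j \<tau>)"
    proof (cases "\<tau> \<in> ?D c")
      case True
      then obtain j where j: "?b \<tau> \<le> c / 4 ^ j" "1 / sqrt (?b \<tau>) \<le> ?w j"
        using inverse_sqrt_dyadic_bound by blast
      have "a \<tau> / sqrt (?b \<tau>) \<le> ?w j * a \<tau>" using mult_right_mono[OF j(2) a] by simp
      then have "ennreal (a \<tau> / sqrt (?b \<tau>)) * indicator (?D c) \<tau> \<le> ?f j \<tau>"
        using True j(1) a c by (simp add: ennreal_mult''[symmetric] ennreal_leI)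
      also have "?f j \<tau> \<le> (\<Sum>j. ?f j \<tau>)" by (rule term_le_suminf_ennreal)
      finally show ?thesis .
    qed simp
  qed
  also have "\<dots> = (\<Sum>j. \<integral>\<^sup>+\<tau>. ?f j \<tau> \<partial>?L)"
    by (rule nn_integral_suminf) measurable
  also have "\<dots> = (\<Sum>j. ennreal (?w j) * (\<integral>\<^sup>+\<tau>. ennreal (a \<tau>) * indicator (?D (c / 4 ^ j)) \<tau> \<partial>?L))"
    by (intro suminf_cong nn_integral_cmult) measurable
  also have "\<dots> \<le> (\<Sum>j. ennreal (4 * sqrt c * (1/2) ^ Suc j))"
  proof (intro suminf_le)
    fix j
    have "ennreal (?w j) * (\<integral>\<^sup>+\<tau>. ennreal (a \<tau>) * indicator (?D (c / 4 ^ j)) \<tau> \<partial>?L)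
        \<le> ennreal (?w j) * ennreal (c / 4 ^ j)"
      using c by (intro mult_left_mono coeff_level_set_le t) auto
    also have "\<dots> = ennreal (?w j * (c / 4 ^ j))" using c by (intro ennreal_mult[symmetric]) auto
    also have "?w j * (c / 4 ^ j) = 4 * sqrt c * (1/2) ^ Suc j"
    proof -
      have "(4::real) ^ j = 2 ^ j * 2 ^ j" by (simp add: power_mult_distrib[symmetric])
      moreover have "c = sqrt c * sqrt c" using c by simp
      ultimately show ?thesis using c by (simp add: field_simps)
    qed
    finally show "ennreal (?w j) * (\<integral>\<^sup>+\<tau>. ennreal (a \<tau>) * indicator (?D (c / 4 ^ j)) \<tau> \<partial>?L)
        \<le> ennreal (4 * sqrt c * (1/2) ^ Suc j)" .
  qed auto
  also have "\<dots> = ennreal (4 * sqrt c)"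
    using c sums_mult[OF power_half_series, of "4 * sqrt c"] by (intro suminf_ennreal_eq) auto
  finally show ?thesis .
qed

end

section \<open>Potentials of a jointly measurable density\<close>

text \<open>
  The heat kernel times a piecewise linear cutoff that vanishes for \<open>s \<le> \<beta>\<close> and is one for
  \<open>s \<ge> 2 \<beta>\<close>. Inside the kernel \<open>s\<close> is replaced by \<open>max s \<beta>\<close>, which makes no difference where the cutoff
  is nonzero and makes the continuity across \<open>s = 0\<close> evident.
\<close>

definition cut_heat_kernel :: "real \<Rightarrow> 'a::euclidean_space \<Rightarrow> real \<Rightarrow> real" where
  "cut_heat_kernel \<beta> z s = heat_kernel z (max s \<beta>) * min 1 (max 0 (s / \<beta> - 1))"

lemma cut_heat_kernel_continuous:
  assumes "0 < \<beta>"
  shows "continuous_on UNIV (case_prod (cut_heat_kernel \<beta> :: 'a::euclidean_space \<Rightarrow> real \<Rightarrow> real))"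
proof -
  have pos: "0 < max s \<beta>" "max s \<beta> \<noteq> 0" for s using assms by (simp_all add: max_def)
  show ?thesis
    unfolding cut_heat_kernel_def heat_kernel_def split_def if_P[OF pos(1)]
    using assms by (intro continuous_intros) (auto simp only: pos mult_eq_0_iff pi_neq_zero)
qed

lemma cut_heat_kernel_nonneg: "0 < \<beta> \<Longrightarrow> 0 \<le> cut_heat_kernel \<beta> z s"
  by (simp add: cut_heat_kernel_def heat_kernel_nonneg)

lemma cut_heat_kernel_bounded:
  fixes z :: "'a::euclidean_space"
  assumes "0 < \<beta>"
  shows "cut_heat_kernel \<beta> z s \<le> (4 * pi * \<beta>) powr (- (real DIM('a) / 2))"
proof -
  have "cut_heat_kernel \<beta> z s \<le> heat_kernel z (max s \<beta>) * 1"
    unfolding cut_heat_kernel_def by (intro mult_left_mono heat_kernel_nonneg) auto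
  also have "\<dots> \<le> (4 * pi * max s \<beta>) powr (- (real DIM('a) / 2))"
    using heat_kernel_le_diag by simp
  also have "\<dots> \<le> (4 * pi * \<beta>) powr (- (real DIM('a) / 2))"
    using assms by (intro powr_mono2') auto
  finally show ?thesis .
qed

lemma cut_heat_kernel_le:
  assumes "0 < \<beta>" shows "cut_heat_kernel \<beta> z s \<le> heat_kernel z s"
proof (cases "\<beta> < s")
  case True
  then have "cut_heat_kernel \<beta> z s = heat_kernel z s * min 1 (max 0 (s / \<beta> - 1))"
    by (simp add: cut_heat_kernel_def max_def)
  also have "\<dots> \<le> heat_kernel z s * 1" by (intro mult_left_mono heat_kernel_nonneg) auto
  finally show ?thesis by simp
next
  case False
  then have "s / \<beta> - 1 \<le> 0" using assms by simp
  then have "cut_heat_kernel \<beta> z s = 0" by (simp add: cut_heat_kernel_def max_def)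
  then show ?thesis by (simp add: heat_kernel_nonneg)
qed

lemma cut_heat_kernel_eq:
  assumes "0 < \<beta>" "2 * \<beta> \<le> s" shows "cut_heat_kernel \<beta> z s = heat_kernel z s"
proof -
  have "1 \<le> s / \<beta> - 1" using assms by (simp add: field_simps)
  then show ?thesis using assms by (simp add: cut_heat_kernel_def max_def)
qed

text \<open>
  The surface measure enters only through its finiteness and its growth, so it is replaced by an
  arbitrary measure \<open>\<sigma>\<close> with these properties. Measurability of the density is required with respect to
  the product \<open>\<sigma>\<close>-algebra itself, not its completion, so that every section is measurable and no
  exceptional set of times has to be carried along.
\<close>

locale layer_density = time_coefficient +
  fixes \<sigma> :: "'a::euclidean_space measure" and c :: real
    and \<phi> :: "'a \<Rightarrow> real \<Rightarrow> real" and M :: real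
  assumes finite: "finite_measure \<sigma>"
    and ident [measurable]: "(\<lambda>\<xi>. \<xi>) \<in> borel_measurable \<sigma>"
    and growth: "\<And>z \<rho>. 0 < \<rho> \<Longrightarrow> emeasure \<sigma> (space \<sigma> \<inter> cball z \<rho>) \<le> ennreal (c * \<rho> ^ (DIM('a) - 1))"
    and c: "0 \<le> c"
    and density [measurable]: "case_prod \<phi> \<in> borel_measurable (\<sigma> \<Otimes>\<^sub>M lebesgue_on {0..T})"
    and density_bound: "\<And>\<xi> \<tau>. \<xi> \<in> space \<sigma> \<Longrightarrow> \<tau> \<in> {0..T} \<Longrightarrow> \<bar>\<phi> \<xi> \<tau>\<bar> \<le> M"
    and M: "0 \<le> M"
begin

sublocale \<sigma>: finite_measure \<sigma> by (rule finite)

sublocale L: finite_measure "lebesgue_on {0..T}" by (rule finite_measure_lebesgue_on) simp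

definition inner_potential :: "('a \<Rightarrow> real \<Rightarrow> real) \<Rightarrow> 'a \<Rightarrow> real \<Rightarrow> real \<Rightarrow> real" where
  "inner_potential H x t \<tau> = (\<integral>\<xi>. H (x - \<xi>) (coeff_int a t \<tau>) * \<phi> \<xi> \<tau> * a \<tau> \<partial>\<sigma>)"

text \<open>
  The time integral extends over all of \<open>[0,T]\<close>: for \<open>\<tau> > t\<close> the argument \<open>b(t,\<tau>)\<close> is not positive
  and the heat kernel vanishes. A domain of integration that is independent of \<open>t\<close> spares the
  continuity proof a moving limit.
\<close>

definition potential :: "('a \<Rightarrow> real \<Rightarrow> real) \<Rightarrow> 'a \<Rightarrow> real \<Rightarrow> real" where
  "potential H x t = (\<integral>\<tau>. inner_potential H x t \<tau> \<partial>lebesgue_on {0..T})"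

lemma integrand_measurable:
  assumes [measurable]: "case_prod H \<in> borel_measurable (borel \<Otimes>\<^sub>M borel)"
  shows "(\<lambda>(\<tau>, \<xi>). H (x - \<xi>) (coeff_int a t \<tau>) * \<phi> \<xi> \<tau> * a \<tau>)
    \<in> borel_measurable (lebesgue_on {0..T} \<Otimes>\<^sub>M \<sigma>)"
proof -
  have [measurable]: "(\<lambda>(\<tau>, \<xi>). \<phi> \<xi> \<tau>) \<in> borel_measurable (lebesgue_on {0..T} \<Otimes>\<^sub>M \<sigma>)"
    using measurable_compose[OF measurable_pair_swap' density] by (simp add: split_def)
  show ?thesis by measurable
qed

lemma integrand_section_measurable:
  assumes "case_prod H \<in> borel_measurable (borel \<Otimes>\<^sub>M borel)" "\<tau> \<in> {0..T}"
  shows "(\<lambda>\<xi>. H (x - \<xi>) (coeff_int a t \<tau>) * \<phi> \<xi> \<tau> * a \<tau>) \<in> borel_measurable \<sigma>"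
  using measurable_compose[OF measurable_Pair1' integrand_measurable[OF assms(1)], of \<tau>] assms(2)
  by simp

lemma inner_potential_measurable:
  assumes "case_prod H \<in> borel_measurable (borel \<Otimes>\<^sub>M borel)"
  shows "inner_potential H x t \<in> borel_measurable (lebesgue_on {0..T})"
  unfolding inner_potential_def
  by (rule \<sigma>.borel_measurable_lebesgue_integral) (rule integrand_measurable[OF assms])

text \<open>
  For a bounded continuous kernel, dominated convergence applies to the inner integral, with a
  constant majorant on the finite measure \<open>\<sigma>\<close>, and then to the outer one, with a multiple of \<open>a\<close> as
  majorant.
\<close>

lemma potential_continuous:
  assumes H: "continuous_on UNIV (case_prod H)" and D: "\<And>z s. \<bar>H z s\<bar> \<le> D"
  shows "continuous_on (UNIV \<times> {0..T}) (\<lambda>(x, t). potential H x t)"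
proof (rule continuous_on_sequentiallyI)
  fix u :: "nat \<Rightarrow> 'a \<times> real" and p
  assume u: "\<forall>n. u n \<in> UNIV \<times> {0..T}" and p: "p \<in> UNIV \<times> {0..T}" and lim: "u \<longlonglongrightarrow> p"
  obtain x0 t0 where p0: "p = (x0, t0)" by fastforce
  define X where "X n = fst (u n)" for n
  define S where "S n = snd (u n)" for n
  have uXS: "u n = (X n, S n)" for n by (simp add: X_def S_def)
  have X: "X \<longlonglongrightarrow> x0" using tendsto_fst[OF lim] by (simp add: X_def[abs_def] p0)
  have S: "S \<longlonglongrightarrow> t0" using tendsto_snd[OF lim] by (simp add: S_def[abs_def] p0)
  have ST: "S n \<in> {0..T}" for n using u uXS by (metis mem_Sigma_iff)
  have t0: "t0 \<in> {0..T}" using p p0 by simp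
  have Hm: "case_prod H \<in> borel_measurable (borel \<Otimes>\<^sub>M borel)"
    using borel_measurable_continuous_onI[OF H] by (simp add: borel_prod)
  have D0: "0 \<le> D" using D[of 0 0] by linarith
  have prim: "(\<lambda>n. coeff_prim a (S n)) \<longlonglongrightarrow> coeff_prim a t0"
    using ST by (intro continuous_on_tendsto_compose[OF coeff_prim_continuous S t0]) (auto intro!: always_eventually)
  have bd: "\<bar>H z s * \<phi> \<xi> \<tau> * a \<tau>\<bar> \<le> D * M * a \<tau>" if "\<xi> \<in> space \<sigma>" "\<tau> \<in> {0..T}" for z s \<xi> \<tau>
    using D[of z s] density_bound[OF that] a_nonneg[OF that(2)] D0 M
    by (auto simp: abs_mult intro!: mult_mono)
  have inner_lim: "(\<lambda>n. inner_potential H (X n) (S n) \<tau>) \<longlonglongrightarrow> inner_potential H x0 t0 \<tau>"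
    if \<tau>: "\<tau> \<in> {0..T}" for \<tau>
    unfolding inner_potential_def
  proof (rule integral_dominated_convergence[where w = "\<lambda>_. D * M * a \<tau>"])
    show "(\<lambda>\<xi>. H (x0 - \<xi>) (coeff_int a t0 \<tau>) * \<phi> \<xi> \<tau> * a \<tau>) \<in> borel_measurable \<sigma>"
      "(\<lambda>\<xi>. H (X n - \<xi>) (coeff_int a (S n) \<tau>) * \<phi> \<xi> \<tau> * a \<tau>) \<in> borel_measurable \<sigma>" for n
      by (intro integrand_section_measurable[OF Hm \<tau>])+
    have "(\<lambda>n. H (X n - \<xi>) (coeff_int a (S n) \<tau>)) \<longlonglongrightarrow> H (x0 - \<xi>) (coeff_int a t0 \<tau>)" for \<xi>
    proof -
      have "(\<lambda>n. (X n - \<xi>, coeff_int a (S n) \<tau>)) \<longlonglongrightarrow> (x0 - \<xi>, coeff_int a t0 \<tau>)"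
        unfolding coeff_int_def by (intro tendsto_intros X prim)
      then have "(\<lambda>n. case_prod H (X n - \<xi>, coeff_int a (S n) \<tau>)) \<longlonglongrightarrow> case_prod H (x0 - \<xi>, coeff_int a t0 \<tau>)"
        by (intro continuous_on_tendsto_compose[OF H]) auto
      then show ?thesis by simp
    qed
    then show "AE \<xi> in \<sigma>. (\<lambda>n. H (X n - \<xi>) (coeff_int a (S n) \<tau>) * \<phi> \<xi> \<tau> * a \<tau>)
        \<longlonglongrightarrow> H (x0 - \<xi>) (coeff_int a t0 \<tau>) * \<phi> \<xi> \<tau> * a \<tau>"
      by (intro AE_I2 tendsto_intros)
    show "AE \<xi> in \<sigma>. norm (H (X n - \<xi>) (coeff_int a (S n) \<tau>) * \<phi> \<xi> \<tau> * a \<tau>) \<le> D * M * a \<tau>" for n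
      using bd[OF _ \<tau>] by (intro AE_I2) simp
  qed simp
  have inner_bd: "\<bar>inner_potential H x t \<tau>\<bar> \<le> measure \<sigma> (space \<sigma>) * (D * M * a \<tau>)"
    if \<tau>: "\<tau> \<in> {0..T}" for x t \<tau>
  proof -
    have "norm (inner_potential H x t \<tau>) \<le> (\<integral>\<xi>. D * M * a \<tau> \<partial>\<sigma>)"
      unfolding inner_potential_def
    proof (rule order_trans[OF integral_norm_bound], rule integral_mono)
      show int: "integrable \<sigma> (\<lambda>\<xi>. D * M * a \<tau>)" by simp
      show "integrable \<sigma> (\<lambda>\<xi>. norm (H (x - \<xi>) (coeff_int a t \<tau>) * \<phi> \<xi> \<tau> * a \<tau>))"
        using integrand_section_measurable[OF Hm \<tau>]
        by (intro integrable_norm Bochner_Integration.integrable_bound[OF int] AE_I2)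
           (auto intro!: order_trans[OF bd[OF _ \<tau>] abs_ge_self])
    qed (use bd[OF _ \<tau>] in simp)
    then show ?thesis by simp
  qed
  have "(\<lambda>n. potential H (X n) (S n)) \<longlonglongrightarrow> potential H x0 t0"
    unfolding potential_def
  proof (rule integral_dominated_convergence[where w = "\<lambda>\<tau>. measure \<sigma> (space \<sigma>) * (D * M * a \<tau>)"])
    show "integrable (lebesgue_on {0..T}) (\<lambda>\<tau>. measure \<sigma> (space \<sigma>) * (D * M * a \<tau>))"
      by (intro integrable_mult_right a_integrable)
  qed (use inner_lim inner_bd inner_potential_measurable[OF Hm] in auto)
  then show "(\<lambda>n. case u n of (x, t) \<Rightarrow> potential H x t) \<longlonglongrightarrow> (case p of (x, t) \<Rightarrow> potential H x t)"
    by (simp add: uXS p0)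
qed

text \<open>
  Some constant \<open>C\<close> in the bound \<open>C / \<surd>s\<close> of the surface integral of the heat kernel; its value is
  immaterial, but it must not depend on \<open>x\<close>, \<open>t\<close> or the cutoff.
\<close>

definition kernel_const :: real where
  "kernel_const = (SOME C. 0 \<le> C \<and>
     (\<forall>x s. 0 < s \<longrightarrow> (\<integral>\<^sup>+\<xi>. ennreal (heat_kernel (x - \<xi>) s) \<partial>\<sigma>) \<le> ennreal (C / sqrt s)))"

lemma kernel_const:
  "0 \<le> kernel_const"
  "0 < s \<Longrightarrow> (\<integral>\<^sup>+\<xi>. ennreal (heat_kernel (x - \<xi>) s) \<partial>\<sigma>) \<le> ennreal (kernel_const / sqrt s)"
  using someI_ex[OF heat_kernel_surface_integral_le[OF ident growth c, simplified Bex_def]]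
  unfolding kernel_const_def by auto

lemma inner_potential_norm_le:
  assumes Hm: "case_prod H \<in> borel_measurable (borel \<Otimes>\<^sub>M borel)"
    and H: "\<And>z. \<bar>H z (coeff_int a t \<tau>)\<bar> \<le> heat_kernel z (coeff_int a t \<tau>) * indicator {..\<beta>} (coeff_int a t \<tau>)"
    and \<tau>: "\<tau> \<in> {0..T}"
  shows "(\<integral>\<^sup>+\<xi>. ennreal \<bar>H (x - \<xi>) (coeff_int a t \<tau>) * \<phi> \<xi> \<tau> * a \<tau>\<bar> \<partial>\<sigma>)
      \<le> ennreal (M * kernel_const) * (ennreal (a \<tau> / sqrt (coeff_int a t \<tau>))
         * indicator {\<tau>. 0 < coeff_int a t \<tau> \<and> coeff_int a t \<tau> \<le> \<beta>} \<tau>)"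
proof (cases "0 < coeff_int a t \<tau> \<and> coeff_int a t \<tau> \<le> \<beta>")
  case True
  let ?b = "coeff_int a t \<tau>"
  have a: "0 \<le> a \<tau>" by (rule a_nonneg[OF \<tau>])
  have "(\<integral>\<^sup>+\<xi>. ennreal \<bar>H (x - \<xi>) ?b * \<phi> \<xi> \<tau> * a \<tau>\<bar> \<partial>\<sigma>)
      \<le> (\<integral>\<^sup>+\<xi>. ennreal (M * a \<tau>) * ennreal (heat_kernel (x - \<xi>) ?b) \<partial>\<sigma>)"
  proof (rule nn_integral_mono)
    fix \<xi> assume \<xi>: "\<xi> \<in> space \<sigma>"
    have "\<bar>H (x - \<xi>) ?b\<bar> \<le> heat_kernel (x - \<xi>) ?b" using H[of "x - \<xi>"] True by simp
    then have "\<bar>H (x - \<xi>) ?b * \<phi> \<xi> \<tau> * a \<tau>\<bar> \<le> heat_kernel (x - \<xi>) ?b * M * a \<tau>"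
      using density_bound[OF \<xi> \<tau>] a M heat_kernel_nonneg[of "x - \<xi>" ?b]
      by (auto simp: abs_mult intro!: mult_mono)
    also have "\<dots> = M * a \<tau> * heat_kernel (x - \<xi>) ?b" by simp
    finally show "ennreal \<bar>H (x - \<xi>) ?b * \<phi> \<xi> \<tau> * a \<tau>\<bar>
        \<le> ennreal (M * a \<tau>) * ennreal (heat_kernel (x - \<xi>) ?b)"
      using M a heat_kernel_nonneg[of "x - \<xi>" ?b] by (simp add: ennreal_mult[symmetric] ennreal_leI)
  qed
  also have "\<dots> = ennreal (M * a \<tau>) * (\<integral>\<^sup>+\<xi>. ennreal (heat_kernel (x - \<xi>) ?b) \<partial>\<sigma>)"
    by (rule nn_integral_cmult) measurable
  also have "\<dots> \<le> ennreal (M * a \<tau>) * ennreal (kernel_const / sqrt ?b)"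
    using True by (intro mult_left_mono kernel_const) auto
  also have "\<dots> = ennreal (M * kernel_const) * ennreal (a \<tau> / sqrt ?b)"
  proof -
    have "M * a \<tau> * (kernel_const / sqrt ?b) = M * kernel_const * (a \<tau> / sqrt ?b)" by simp
    then show ?thesis using M a kernel_const(1) True by (simp add: ennreal_mult[symmetric] del: times_divide_eq_right)
  qed
  finally show ?thesis using True by simp
next
  case False
  then have z0: "heat_kernel z (coeff_int a t \<tau>) * indicator {..\<beta>} (coeff_int a t \<tau>) = 0" for z :: 'a
    by (auto simp: heat_kernel_def indicator_def)
  have "H z (coeff_int a t \<tau>) = 0" for z using H[of z] unfolding z0 by simp
  then show ?thesis by simp
qed

text \<open>
  All kernels in use, namely the heat kernel, its cutoffs and their differences, are dominated by the
  heat kernel on a range \<open>b \<le> \<beta>\<close>, so that a single estimate provides integrability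
  and, if the range is small, a small potential.
\<close>

lemma dominated_potential:
  assumes Hm: "case_prod H \<in> borel_measurable (borel \<Otimes>\<^sub>M borel)"
    and H: "\<And>z \<tau>. \<tau> \<in> {0..T} \<Longrightarrow>
      \<bar>H z (coeff_int a t \<tau>)\<bar> \<le> heat_kernel z (coeff_int a t \<tau>) * indicator {..\<beta>} (coeff_int a t \<tau>)"
    and t: "t \<in> {0..T}" and \<beta>: "0 < \<beta>"
  shows inner_integrable: "\<And>\<tau>. \<tau> \<in> {0..T} \<Longrightarrow>
      integrable \<sigma> (\<lambda>\<xi>. H (x - \<xi>) (coeff_int a t \<tau>) * \<phi> \<xi> \<tau> * a \<tau>)"
    and outer_integrable: "integrable (lebesgue_on {0..T}) (inner_potential H x t)"
    and potential_le: "\<bar>potential H x t\<bar> \<le> 4 * M * kernel_const * sqrt \<beta>"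
proof -
  let ?b = "coeff_int a t"
  let ?g = "\<lambda>\<tau>. ennreal (M * kernel_const) * (ennreal (a \<tau> / sqrt (?b \<tau>))
         * indicator {\<tau>. 0 < ?b \<tau> \<and> ?b \<tau> \<le> \<beta>} \<tau>)"
  have le: "(\<integral>\<^sup>+\<xi>. norm (H (x - \<xi>) (?b \<tau>) * \<phi> \<xi> \<tau> * a \<tau>) \<partial>\<sigma>) \<le> ?g \<tau>" if "\<tau> \<in> {0..T}" for \<tau>
    using inner_potential_norm_le[OF Hm H[OF that] that] by simp
  show int: "integrable \<sigma> (\<lambda>\<xi>. H (x - \<xi>) (?b \<tau>) * \<phi> \<xi> \<tau> * a \<tau>)" if \<tau>: "\<tau> \<in> {0..T}" for \<tau>
  proof (rule integrableI_bounded)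
    have "?g \<tau> < \<infinity>" by (simp add: ennreal_mult_less_top indicator_def)
    then show "(\<integral>\<^sup>+\<xi>. norm (H (x - \<xi>) (?b \<tau>) * \<phi> \<xi> \<tau> * a \<tau>) \<partial>\<sigma>) < \<infinity>"
      using le[OF \<tau>] by (rule le_less_trans[rotated])
  qed (rule integrand_section_measurable[OF Hm \<tau>])
  have "(\<integral>\<^sup>+\<tau>. norm (inner_potential H x t \<tau>) \<partial>lebesgue_on {0..T}) \<le> (\<integral>\<^sup>+\<tau>. ?g \<tau> \<partial>lebesgue_on {0..T})"
  proof (rule nn_integral_mono)
    fix \<tau> assume "\<tau> \<in> space (lebesgue_on {0..T})"
    then have \<tau>: "\<tau> \<in> {0..T}" by simp
    have "ennreal (norm (inner_potential H x t \<tau>)) \<le> (\<integral>\<^sup>+\<xi>. norm (H (x - \<xi>) (?b \<tau>) * \<phi> \<xi> \<tau> * a \<tau>) \<partial>\<sigma>)"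
      unfolding inner_potential_def by (rule integral_norm_bound_ennreal[OF int[OF \<tau>]])
    also have "\<dots> \<le> ?g \<tau>" by (rule le[OF \<tau>])
    finally show "ennreal (norm (inner_potential H x t \<tau>)) \<le> ?g \<tau>" .
  qed
  also have "\<dots> = ennreal (M * kernel_const) * (\<integral>\<^sup>+\<tau>. ennreal (a \<tau> / sqrt (?b \<tau>))
         * indicator {\<tau>. 0 < ?b \<tau> \<and> ?b \<tau> \<le> \<beta>} \<tau> \<partial>lebesgue_on {0..T})"
    by (rule nn_integral_cmult) measurable
  also have "\<dots> \<le> ennreal (M * kernel_const) * ennreal (4 * sqrt \<beta>)"
    by (intro mult_left_mono inverse_sqrt_coeff_integral_le[OF t \<beta>]) simp
  also have "\<dots> = ennreal (4 * M * kernel_const * sqrt \<beta>)"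
    using M kernel_const(1) \<beta> by (simp add: ennreal_mult[symmetric] mult_ac)
  finally have nn: "(\<integral>\<^sup>+\<tau>. norm (inner_potential H x t \<tau>) \<partial>lebesgue_on {0..T})
      \<le> ennreal (4 * M * kernel_const * sqrt \<beta>)" .
  show out: "integrable (lebesgue_on {0..T}) (inner_potential H x t)"
    using nn by (intro integrableI_bounded inner_potential_measurable[OF Hm])
      (auto intro: le_less_trans)
  have "ennreal (norm (potential H x t)) \<le> ennreal (4 * M * kernel_const * sqrt \<beta>)"
    unfolding potential_def by (rule order_trans[OF integral_norm_bound_ennreal[OF out] nn])
  then show "\<bar>potential H x t\<bar> \<le> 4 * M * kernel_const * sqrt \<beta>"
    using M kernel_const(1) \<beta> by (subst (asm) ennreal_le_iff) auto
qed

lemma coeff_int_le_total: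
  assumes "t \<in> {0..T}" "\<tau> \<in> {0..T}" shows "coeff_int a t \<tau> \<le> coeff_prim a T"
proof -
  have "0 \<le> coeff_int a T t" "0 \<le> coeff_int a \<tau> 0" using assms by (auto intro!: coeff_int_nonneg)
  moreover have "coeff_prim a 0 = 0" using assms by (simp add: coeff_prim_eq_integral)
  ultimately show ?thesis by (simp add: coeff_int_def)
qed

lemma coeff_prim_total_nonneg: "0 \<le> T \<Longrightarrow> 0 \<le> coeff_prim a T"
  using coeff_int_le_total[of T T] by (simp add: coeff_int_def)

text \<open>
  The values of \<open>b\<close> never exceed \<open>a\<^sub>1(T)\<close>, so a range that covers them all imposes no restriction.
  The summand \<open>1\<close> keeps its upper end positive even if \<open>a\<close> vanishes almost everywhere.
\<close>

lemma heat_dominated: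
  assumes "t \<in> {0..T}" "\<tau> \<in> {0..T}"
    and "\<And>z s. \<bar>H z s\<bar> \<le> heat_kernel z s"
  shows "\<bar>H z (coeff_int a t \<tau>)\<bar>
     \<le> heat_kernel z (coeff_int a t \<tau>) * indicator {..coeff_prim a T + 1} (coeff_int a t \<tau>)"
  using assms(3) coeff_int_le_total[OF assms(1,2)] by simp

lemma heat_inner_integrable:
  assumes "t \<in> {0..T}" "\<tau> \<in> {0..T}"
  shows "integrable \<sigma> (\<lambda>\<xi>. heat_kernel (x - \<xi>) (coeff_int a t \<tau>) * \<phi> \<xi> \<tau> * a \<tau>)"
proof (rule inner_integrable[OF heat_kernel_measurable _ assms(1) _ assms(2)])
  show "\<bar>heat_kernel z (coeff_int a t \<tau>)\<bar>
      \<le> heat_kernel z (coeff_int a t \<tau>) * indicator {..coeff_prim a T + 1} (coeff_int a t \<tau>)"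
    if "\<tau> \<in> {0..T}" for z :: 'a and \<tau>
    by (rule heat_dominated[OF assms(1) that]) (simp add: heat_kernel_nonneg)
  show "0 < coeff_prim a T + 1" using coeff_prim_total_nonneg assms by fastforce
qed

lemma heat_outer_integrable:
  assumes "t \<in> {0..T}"
  shows "integrable (lebesgue_on {0..T}) (inner_potential heat_kernel x t)"
proof (rule outer_integrable[OF heat_kernel_measurable _ assms])
  show "\<bar>heat_kernel z (coeff_int a t \<tau>)\<bar>
      \<le> heat_kernel z (coeff_int a t \<tau>) * indicator {..coeff_prim a T + 1} (coeff_int a t \<tau>)"
    if "\<tau> \<in> {0..T}" for z :: 'a and \<tau>
    by (rule heat_dominated[OF assms that]) (simp add: heat_kernel_nonneg)
  show "0 < coeff_prim a T + 1" using coeff_prim_total_nonneg assms by fastforce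
qed

text \<open>
  The cutoff changes the kernel only where \<open>b \<le> 2 \<beta>\<close>, and the bound is independent of the point
  \<open>(x,t)\<close>: this uniformity is what carries continuity over to the limit.
\<close>

lemma potential_cut_approx:
  assumes t: "t \<in> {0..T}" and \<beta>: "0 < \<beta>"
  shows "\<bar>potential heat_kernel x t - potential (cut_heat_kernel \<beta>) x t\<bar>
    \<le> 4 * M * kernel_const * sqrt (2 * \<beta>)"
proof -
  let ?H = "cut_heat_kernel \<beta> :: 'a \<Rightarrow> real \<Rightarrow> real" and ?K = "heat_kernel :: 'a \<Rightarrow> real \<Rightarrow> real"
  have Hm[measurable]: "case_prod ?H \<in> borel_measurable (borel \<Otimes>\<^sub>M borel)"
    using borel_measurable_continuous_onI[OF cut_heat_kernel_continuous[OF \<beta>]]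
    by (simp add: borel_prod)
  have dm: "case_prod (\<lambda>z s. ?K z s - ?H z s) \<in> borel_measurable (borel \<Otimes>\<^sub>M borel)"
    unfolding split_def by measurable
  have T: "0 < coeff_prim a T + 1" using coeff_prim_total_nonneg t by fastforce
  have Hb: "\<bar>?H z s\<bar> \<le> ?K z s" for z s
    using cut_heat_kernel_le[OF \<beta>, of z s] cut_heat_kernel_nonneg[OF \<beta>, of z s] by simp
  have Hdom: "\<bar>?H z (coeff_int a t \<tau>)\<bar>
      \<le> ?K z (coeff_int a t \<tau>) * indicator {..coeff_prim a T + 1} (coeff_int a t \<tau>)"
    if "\<tau> \<in> {0..T}" for z \<tau>
    by (rule heat_dominated[OF t that Hb])
  have "inner_potential (\<lambda>z s. ?K z s - ?H z s) x t \<tau>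
      = inner_potential ?K x t \<tau> - inner_potential ?H x t \<tau>" if \<tau>: "\<tau> \<in> {0..T}" for \<tau>
    unfolding inner_potential_def
    using heat_inner_integrable[OF t \<tau>] inner_integrable[OF Hm Hdom t T \<tau>]
    by (subst Bochner_Integration.integral_diff[symmetric]) (auto simp: algebra_simps)
  then have "potential (\<lambda>z s. ?K z s - ?H z s) x t
      = (\<integral>\<tau>. inner_potential ?K x t \<tau> - inner_potential ?H x t \<tau> \<partial>lebesgue_on {0..T})"
    unfolding potential_def by (intro Bochner_Integration.integral_cong) auto
  also have "\<dots> = potential ?K x t - potential ?H x t"
    unfolding potential_def
    by (intro Bochner_Integration.integral_diff heat_outer_integrable[OF t] outer_integrable[OF Hm Hdom t T])
  finally have eq: "potential (\<lambda>z s. ?K z s - ?H z s) x t = potential ?K x t - potential ?H x t" .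
  have "\<bar>?K z s - ?H z s\<bar> \<le> ?K z s * indicator {..2 * \<beta>} s" for z s
  proof (cases "s \<le> 2 * \<beta>")
    case True
    then show ?thesis using cut_heat_kernel_le[OF \<beta>, of z s] cut_heat_kernel_nonneg[OF \<beta>, of z s] by simp
  next
    case False
    then show ?thesis using cut_heat_kernel_eq[OF \<beta>, of s z] by simp
  qed
  then show ?thesis
    using potential_le[OF dm, of t "2 * \<beta>" x] t \<beta> unfolding eq by simp
qed

lemma heat_potential_continuous:
  "continuous_on (UNIV \<times> {0..T}) (\<lambda>(x, t). potential heat_kernel x t)"
proof (rule uniform_limit_theorem)
  let ?\<beta> = "\<lambda>n. inverse (real (Suc n))"
  show "\<forall>\<^sub>F n in sequentially. continuous_on (UNIV \<times> {0..T}) (\<lambda>(x, t). potential (cut_heat_kernel (?\<beta> n)) x t)"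
  proof (intro always_eventually allI potential_continuous)
    fix n show "continuous_on UNIV (case_prod (cut_heat_kernel (?\<beta> n) :: 'a \<Rightarrow> _))"
      by (rule cut_heat_kernel_continuous) simp
    fix z :: 'a and s
    show "\<bar>cut_heat_kernel (?\<beta> n) z s\<bar> \<le> (4 * pi * ?\<beta> n) powr (- (real DIM('a) / 2))"
      using cut_heat_kernel_bounded[of "?\<beta> n" z s] cut_heat_kernel_nonneg[of "?\<beta> n" z s] by simp
  qed
  show "uniform_limit (UNIV \<times> {0..T}) (\<lambda>n (x, t). potential (cut_heat_kernel (?\<beta> n)) x t)
      (\<lambda>(x, t). potential heat_kernel x t) sequentially"
  proof (rule uniform_limitI)
    fix e :: real assume e: "0 < e"
    have "(\<lambda>n. 4 * M * kernel_const * sqrt (2 * ?\<beta> n)) \<longlonglongrightarrow> 4 * M * kernel_const * sqrt (2 * 0)"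
      by (intro tendsto_intros LIMSEQ_inverse_real_of_nat)
    then have "\<forall>\<^sub>F n in sequentially. 4 * M * kernel_const * sqrt (2 * ?\<beta> n) < e"
      using e by (intro order_tendstoD(2)) auto
    then show "\<forall>\<^sub>F n in sequentially. \<forall>p\<in>UNIV \<times> {0..T}.
        dist (case p of (x, t) \<Rightarrow> potential (cut_heat_kernel (?\<beta> n)) x t)
          (case p of (x, t) \<Rightarrow> potential heat_kernel x t) < e"
    proof eventually_elim
      case (elim n)
      have "dist (potential (cut_heat_kernel (?\<beta> n)) x t) (potential heat_kernel x t) < e"
        if "t \<in> {0..T}" for x t
        using potential_cut_approx[OF that, of "?\<beta> n" x] elim by (simp add: dist_real_def abs_minus_commute)
      then show ?case by auto
    qed
  qed
qed simp

lemma heat_potential_upto: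
  assumes t: "t \<in> {0..T}"
  shows "s \<le> T \<Longrightarrow> set_integrable lebesgue {0..s} (inner_potential heat_kernel x t)"
    and "(LINT \<tau>:{0..t}|lebesgue. inner_potential heat_kernel x t \<tau>) = potential heat_kernel x t"
proof -
  have int: "set_integrable lebesgue {0..T} (inner_potential heat_kernel x t)"
    using heat_outer_integrable[OF t] by (simp add: set_integrable_def integrable_restrict_space)
  then show "set_integrable lebesgue {0..s} (inner_potential heat_kernel x t)" if "s \<le> T"
    by (rule set_integrable_subset) (use that in auto)
  \<comment> \<open>times after \<open>t\<close> contribute nothing, so that integrating up to \<open>T\<close> or up to \<open>t\<close> is the same\<close>
  have zero: "inner_potential heat_kernel x t \<tau> = 0" if "t < \<tau>" "\<tau> \<le> T" for \<tau>
  proof -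
    have "\<not> 0 < coeff_int a t \<tau>" using coeff_int_pos_imp_less[of t \<tau>] that t by auto
    then show ?thesis by (simp add: inner_potential_def heat_kernel_def)
  qed
  have "(LINT \<tau>:{0..t}|lebesgue. inner_potential heat_kernel x t \<tau>)
      = (\<integral>\<tau>. indicator {0..T} \<tau> *\<^sub>R inner_potential heat_kernel x t \<tau> \<partial>lebesgue)"
    unfolding set_lebesgue_integral_def using t
    by (intro Bochner_Integration.integral_cong) (auto simp: indicator_def zero)
  then show "(LINT \<tau>:{0..t}|lebesgue. inner_potential heat_kernel x t \<tau>) = potential heat_kernel x t"
    by (simp add: potential_def integral_restrict_space)
qed

text \<open>
  As the inner potential is integrable up to \<open>\<tau> = t\<close>, its indefinite integral is continuous there, and the
  improper integral is an ordinary one.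
\<close>

lemma heat_potential_improper:
  assumes t: "0 < t" "t \<le> T"
  shows "((\<lambda>h. LINT \<tau>:{0..t - h}|lebesgue. inner_potential heat_kernel x t \<tau>) \<longlongrightarrow> potential heat_kernel x t) (at_right 0)"
proof -
  let ?F = "\<lambda>s. LINT \<tau>:{0..s}|lebesgue. inner_potential heat_kernel x t \<tau>"
  have "continuous_on {0..t} ?F"
    using t by (intro LINT_upper_limit_continuous heat_potential_upto) auto
  then have "(?F \<longlongrightarrow> ?F t) (at t within {0..t})" using t by (auto simp: continuous_on_def)
  moreover have "filterlim (\<lambda>h. t - h) (at t within {0..t}) (at_right 0)"
    unfolding filterlim_at
  proof
    show "((\<lambda>h. t - h) \<longlongrightarrow> t) (at_right 0)" by (auto intro!: tendsto_eq_intros)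
    show "\<forall>\<^sub>F h in at_right 0. t - h \<in> {0..t} \<and> t - h \<noteq> t"
      using eventually_at_right_less[of 0] eventually_at_right_real[OF t(1)]
      by eventually_elim auto
  qed
  ultimately have "((\<lambda>h. ?F (t - h)) \<longlongrightarrow> ?F t) (at_right 0)" by (rule filterlim_compose)
  then show ?thesis using t by (simp add: heat_potential_upto)
qed

end

section \<open>Replacing the density by a jointly measurable one\<close>

lemma (in complete_measure) borel_measurable_AE_eq:
  fixes f g :: "'a \<Rightarrow> 'b::topological_space"
  assumes g: "g \<in> borel_measurable M" and ae: "AE x in M. g x = f x"
  shows "f \<in> borel_measurable M"
proof (rule measurableI)
  fix A :: "'b set" assume "A \<in> sets borel"
  then have g': "g -` A \<inter> space M \<in> sets M" by (rule measurable_sets[OF g])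
  have "AE x in M. x \<in> g -` A \<inter> space M \<longleftrightarrow> x \<in> f -` A \<inter> space M"
    using ae by eventually_elim auto
  then show "f -` A \<inter> space M \<in> sets M" using g' by (rule in_sets_AE) simp
qed simp

lemma (in complete_measure) integrable_AE_eq:
  fixes f g :: "'a \<Rightarrow> 'b::{banach, second_countable_topology}"
  assumes g: "integrable M g" and ae: "AE x in M. g x = f x"
  shows "integrable M f" "integral\<^sup>L M f = integral\<^sup>L M g"
proof -
  have f: "f \<in> borel_measurable M"
    using g by (intro borel_measurable_AE_eq[OF _ ae]) auto
  show "integrable M f" by (rule integrable_cong_AE_imp[OF g f ae])
  show "integral\<^sup>L M f = integral\<^sup>L M g"
    using f g ae by (intro integral_cong_AE) auto
qed

text \<open>
  The exceptional set is first enlarged to a measurable null set, as exchanging the order of the two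
  almost-everywhere quantifiers requires a measurable property.
\<close>

lemma (in pair_sigma_finite) AE_pair_swap:
  assumes "AE p in M1 \<Otimes>\<^sub>M M2. Q p"
  shows "AE y in M2. AE x in M1. Q (x, y)"
proof -
  obtain N where N: "{p \<in> space (M1 \<Otimes>\<^sub>M M2). \<not> Q p} \<subseteq> N" "N \<in> null_sets (M1 \<Otimes>\<^sub>M M2)"
    using assms by (auto elim!: AE_E simp: null_sets_def)
  have "AE p in M1 \<Otimes>\<^sub>M M2. p \<notin> N" by (rule AE_not_in[OF N(2)])
  then have "AE x in M1. AE y in M2. (x, y) \<notin> N" by (rule AE_pair)
  moreover have "{p \<in> space (M1 \<Otimes>\<^sub>M M2). (fst p, snd p) \<notin> N} \<in> sets (M1 \<Otimes>\<^sub>M M2)"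
  proof -
    have "{p \<in> space (M1 \<Otimes>\<^sub>M M2). (fst p, snd p) \<notin> N} = space (M1 \<Otimes>\<^sub>M M2) - N" by auto
    then show ?thesis using N(2) by auto
  qed
  ultimately have "AE y in M2. AE x in M1. (x, y) \<notin> N" by (subst (asm) AE_commute)
  then show ?thesis
  proof (rule AE_mp[OF _ AE_I2], intro impI)
    fix y assume y: "y \<in> space M2" and ae: "AE x in M1. (x, y) \<notin> N"
    show "AE x in M1. Q (x, y)"
      using ae AE_space by eventually_elim (use N(1) y in \<open>auto simp: space_pair_measure\<close>)
  qed
qed

text \<open>
  A representative that is measurable for the uncompleted product need not obey the bound on the
  exceptional null set; truncation restores it everywhere.
\<close>

lemma bounded_measurable_representative:
  fixes \<phi> :: "'a \<Rightarrow> 'b \<Rightarrow> real"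
  assumes meas: "case_prod \<phi> \<in> borel_measurable (completion (M1 \<Otimes>\<^sub>M M2))"
    and bd: "\<And>x y. x \<in> space M1 \<Longrightarrow> y \<in> space M2 \<Longrightarrow> \<bar>\<phi> x y\<bar> \<le> M" and M: "0 \<le> M"
  shows "\<exists>\<psi>. case_prod \<psi> \<in> borel_measurable (M1 \<Otimes>\<^sub>M M2) \<and> (\<forall>x y. \<bar>\<psi> x y\<bar> \<le> M)
    \<and> (AE p in M1 \<Otimes>\<^sub>M M2. case_prod \<psi> p = case_prod \<phi> p)"
proof -
  obtain \<psi>0 where \<psi>0[measurable]: "\<psi>0 \<in> borel_measurable (M1 \<Otimes>\<^sub>M M2)"
    and ae: "AE p in M1 \<Otimes>\<^sub>M M2. case_prod \<phi> p = \<psi>0 p"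
    using completion_ex_borel_measurable_real[OF meas] by blast
  define \<psi> where "\<psi> x y = max (- M) (min M (\<psi>0 (x, y)))" for x y
  have "case_prod \<psi> \<in> borel_measurable (M1 \<Otimes>\<^sub>M M2)"
    unfolding \<psi>_def split_def by measurable
  moreover have "\<bar>\<psi> x y\<bar> \<le> M" for x y using M by (auto simp: \<psi>_def)
  moreover have "AE p in M1 \<Otimes>\<^sub>M M2. case_prod \<psi> p = case_prod \<phi> p"
    using ae AE_space
  proof eventually_elim
    case (elim p)
    obtain x y where p: "p = (x, y)" by fastforce
    then have "x \<in> space M1" "y \<in> space M2" using elim(2) by (simp_all add: space_pair_measure)
    then have "\<bar>\<phi> x y\<bar> \<le> M" by (rule bd)
    then show ?case using elim p by (auto simp: \<psi>_def)
  qed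
  ultimately show ?thesis by blast
qed

section \<open>Continuity of the single layer potential\<close>

theorem theorem3p1:
  fixes T lam :: real
    and \<Omega> :: "(real ^ 'n) set"
    and a :: "real \<Rightarrow> real"
    and \<phi> :: "real ^ 'n \<Rightarrow> real \<Rightarrow> real"
  assumes T: "0 < T"
    and dim: "CARD('n) \<ge> 2"
    and domain: "open \<Omega>" "connected \<Omega>" "\<Omega> \<noteq> {}" "bounded \<Omega>"
    and lam: "0 < lam" "lam < 1"
    and boundary: "C1_holder_boundary lam \<Omega>"
    and a_L1: "set_integrable lebesgue {0..T} a"
    and a_nonneg: "\<forall>t\<in>{0..T}. 0 \<le> a t"
    and a_zeros: "discrete {t \<in> {0..T}. a t = 0}"
    and phi_meas: "(\<lambda>(\<xi>, \<tau>). \<phi> \<xi> \<tau>) \<in>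
        borel_measurable (completion (surface_measure \<Omega> \<Otimes>\<^sub>M lebesgue_on {0..T}))"
    and phi_bounded: "bounded ((\<lambda>(\<xi>, \<tau>). \<phi> \<xi> \<tau>) ` (frontier \<Omega> \<times> {0..T}))"
  shows "(\<forall>x. \<forall>t\<in>{0<..T}. single_layer_exists a \<Omega> \<phi> x t) \<and>
         continuous_on (UNIV \<times> {0<..T}) (\<lambda>(x, t). single_layer a \<Omega> \<phi> x t) \<and>
         (\<forall>x\<in>frontier \<Omega>. \<forall>t\<in>{0<..T}.
            ((\<lambda>(y, s). single_layer a \<Omega> \<phi> y s) \<longlongrightarrow> single_layer a \<Omega> \<phi> x t)
              (at (x, t) within \<Omega> \<times> {0<..T}) \<and>
            ((\<lambda>(y, s). single_layer a \<Omega> \<phi> y s) \<longlongrightarrow> single_layer a \<Omega> \<phi> x t)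
              (at (x, t) within (- closure \<Omega>) \<times> {0<..T}))"
proof -
  let ?S = "surface_measure \<Omega>" and ?L = "lebesgue_on {0..T}"
  obtain c where c: "0 \<le> c" and growth: "\<And>z \<rho>. 0 < \<rho> \<Longrightarrow>
      emeasure ?S (frontier \<Omega> \<inter> cball z \<rho>) \<le> ennreal (c * \<rho> ^ (DIM(real ^ 'n) - 1))"
    using surface_measure_growth[OF domain(1,4) less_imp_le[OF lam(1)] boundary] by blast
  obtain M0 where M0: "\<And>p. p \<in> frontier \<Omega> \<times> {0..T} \<Longrightarrow> \<bar>case p of (\<xi>, \<tau>) \<Rightarrow> \<phi> \<xi> \<tau>\<bar> \<le> M0"
    using phi_bounded unfolding bounded_iff by auto
  define M where "M = max 0 M0"
  have M: "0 \<le> M" "\<And>\<xi> \<tau>. \<xi> \<in> space ?S \<Longrightarrow> \<tau> \<in> space ?L \<Longrightarrow> \<bar>\<phi> \<xi> \<tau>\<bar> \<le> M"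
    using M0 by (fastforce simp: M_def space_surface_measure)+
  obtain \<psi> where \<psi>: "case_prod \<psi> \<in> borel_measurable (?S \<Otimes>\<^sub>M ?L)" "\<And>\<xi> \<tau>. \<bar>\<psi> \<xi> \<tau>\<bar> \<le> M"
    and \<psi>_ae: "AE p in ?S \<Otimes>\<^sub>M ?L. case_prod \<psi> p = case_prod \<phi> p"
    using bounded_measurable_representative[OF phi_meas M(2,1)] by blast
  interpret layer_density T a ?S c \<psi> M
  proof (intro layer_density.intro time_coefficient.intro layer_density_axioms.intro)
    show "finite_measure ?S" by (rule finite_surface_measure[OF domain(4) growth])
    show "emeasure ?S (space ?S \<inter> cball z \<rho>) \<le> ennreal (c * \<rho> ^ (DIM(real ^ 'n) - 1))" if "0 < \<rho>" for z \<rho>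
      using growth[OF that] by (simp only: space_surface_measure)
  qed (use a_nonneg in \<open>simp_all only: a_L1 c \<psi> M(1) ident_measurable_surface_measure\<close>)
  interpret P: pair_sigma_finite ?S ?L ..
  interpret C: complete_measure ?S
    unfolding surface_measure_def by (rule completion.complete_measure_axioms)
  have \<psi>_AE: "AE \<tau> in ?L. AE \<xi> in ?S. \<psi> \<xi> \<tau> = \<phi> \<xi> \<tau>"
    using P.AE_pair_swap[OF \<psi>_ae] by simp
  \<comment> \<open>\<open>\<sigma>\<close> is complete, so for almost every \<open>\<tau>\<close> the section of the integrand with \<open>\<phi>\<close> inherits measurability from that with \<open>\<psi>\<close>\<close>
  have inner: "AE \<tau> in lebesgue. \<tau> \<in> {0..T} \<longrightarrow>
      integrable ?S (layer_integrand a \<phi> x t \<tau>) \<and>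
      (LINT \<xi>|?S. layer_integrand a \<phi> x t \<tau> \<xi>) = inner_potential heat_kernel x t \<tau>"
    if t: "t \<in> {0..T}" for x t
  proof -
    have "AE \<tau> in ?L. integrable ?S (layer_integrand a \<phi> x t \<tau>) \<and>
      (LINT \<xi>|?S. layer_integrand a \<phi> x t \<tau> \<xi>) = inner_potential heat_kernel x t \<tau>"
      using \<psi>_AE AE_space
    proof eventually_elim
      case (elim \<tau>)
      have "AE \<xi> in ?S. heat_kernel (x - \<xi>) (coeff_int a t \<tau>) * \<psi> \<xi> \<tau> * a \<tau>
          = layer_integrand a \<phi> x t \<tau> \<xi>"
        using elim(1) by eventually_elim (simp add: layer_integrand_def)
      moreover have "integrable ?S (\<lambda>\<xi>. heat_kernel (x - \<xi>) (coeff_int a t \<tau>) * \<psi> \<xi> \<tau> * a \<tau>)"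
        using elim(2) by (intro heat_inner_integrable[OF t]) simp
      ultimately show ?case
        using C.integrable_AE_eq unfolding inner_potential_def by blast
    qed
    then show ?thesis by (subst (asm) AE_restrict_space_iff) simp_all
  qed
  have upto: "single_layer_integrable_upto a \<Omega> \<phi> x t s"
      "single_layer_upto a \<Omega> \<phi> x t s = (LINT \<tau>:{0..s}|lebesgue. inner_potential heat_kernel x t \<tau>)"
    if t: "t \<in> {0..T}" and s: "s \<le> T" for x t s
  proof -
    let ?G = "\<lambda>\<tau>. LINT \<xi>|?S. layer_integrand a \<phi> x t \<tau> \<xi>"
    have "AE \<tau> in lebesgue. indicator {0..s} \<tau> *\<^sub>R inner_potential heat_kernel x t \<tau> = indicator {0..s} \<tau> *\<^sub>R ?G \<tau>"
      using inner[OF t, of x] by eventually_elim (use s in \<open>auto simp: indicator_def\<close>)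
    note * = completion.integrable_AE_eq[OF heat_potential_upto(1)[OF t s, unfolded set_integrable_def] this]
    have "AE \<tau> in lebesgue_on {0..s}. integrable ?S (layer_integrand a \<phi> x t \<tau>)"
      unfolding AE_restrict_space_iff[of "{0..s}" lebesgue, simplified]
      using inner[OF t, of x] by eventually_elim (use s in auto)
    then show "single_layer_integrable_upto a \<Omega> \<phi> x t s"
      using *(1) by (simp add: single_layer_integrable_upto_def set_integrable_def)
    show "single_layer_upto a \<Omega> \<phi> x t s = (LINT \<tau>:{0..s}|lebesgue. inner_potential heat_kernel x t \<tau>)"
      using *(2) by (simp add: single_layer_upto_def set_lebesgue_integral_def)
  qed
  have improper: "((\<lambda>h. single_layer_upto a \<Omega> \<phi> x t (t - h)) \<longlongrightarrow> potential heat_kernel x t) (at_right 0)"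
    if t: "t \<in> {0<..T}" for x t
  proof -
    have "\<forall>\<^sub>F h in at_right 0. single_layer_upto a \<Omega> \<phi> x t (t - h)
        = (LINT \<tau>:{0..t - h}|lebesgue. inner_potential heat_kernel x t \<tau>)"
      using eventually_at_right_less[of 0] by eventually_elim (use t in \<open>auto intro!: upto\<close>)
    then show ?thesis
      using heat_potential_improper[of t x] t by (subst tendsto_cong) auto
  qed
  have eq: "single_layer a \<Omega> \<phi> x t = potential heat_kernel x t" if t: "t \<in> {0<..T}" for x t
    using tendsto_Lim[OF trivial_limit_at_right_real improper[OF t, of x]]
      upto(2)[of t t x] heat_potential_upto(2)[of t x] t
    by (auto simp: single_layer_def)
  have ex: "single_layer_exists a \<Omega> \<phi> x t" if t: "t \<in> {0<..T}" for x t
    using improper[OF t, of x] upto(1)[of t _ x] t by (auto simp: single_layer_exists_def)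
  have "continuous_on (UNIV \<times> {0<..T}) (\<lambda>(x, t). potential heat_kernel x t)"
    by (rule continuous_on_subset[OF heat_potential_continuous]) auto
  then have cont: "continuous_on (UNIV \<times> {0<..T}) (\<lambda>(x, t). single_layer a \<Omega> \<phi> x t)"
    by (rule continuous_on_eq) (auto simp: eq)
  have "((\<lambda>(y, s). single_layer a \<Omega> \<phi> y s) \<longlongrightarrow> single_layer a \<Omega> \<phi> x t) (at (x, t) within A \<times> {0<..T})"
    if "t \<in> {0<..T}" for x t A
  proof -
    have "((\<lambda>(y, s). single_layer a \<Omega> \<phi> y s) \<longlongrightarrow> single_layer a \<Omega> \<phi> x t) (at (x, t) within UNIV \<times> {0<..T})"
      using cont that unfolding continuous_on_def by fastforce
    then show ?thesis by (rule tendsto_within_subset) auto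
  qed
  then show ?thesis using ex cont by blast
qed

end
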